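(* Let $K$ be a finite simplicial complex and $\phi:|K|\to\mathbb{R}^{N+1}$ a geometric complex. Let $(\mathbb{S}^N,\mathcal{C})$ be the induced cellulation, let $k$ be a field and let $d\in\mathbb{N}$. For $\mu\in\mathbb{S}^N$ let $P_\mu$ be the totally ordered poset and $F_\mu:P_\mu\to\Delta K$ the filtration associated with the height function $\phi_\mu$ (all as defined in the context). Then: (1) If $\mu_1,\mu_2\in\mathbb{S}^N$ lie in the same cell $C\in\mathcal{C}$, then $P_{\mu_1}=P_{\mu_2}$ and $F_{\mu_1}=F_{\mu_2}$. Hence $F(C):=F_\mu$, for any $\mu\in C$, is a well-defined object of $\mathrm{Fil}(K)$, and the $d$-th persistence diagrams $\mathrm{PH}_d(F_{\mu_1})$ and $\mathrm{PH}_d(F_{\mu_2})$ are equal. (2) If $C_1\le C_2$ in $\mathcal{C}$, $\nu\in C_1$ and $\mu\in C_2$, then the assignment $\alpha([v]_\mu):=[v]_\nu$ for $v\in K^0$, $\alpha(\top):=\top$, is a well-defined bounded monotone function $\alpha:P_\mu\to P_\nu$, and $F(C_1\le C_2):=(F(C_2),F(C_1),\alpha)$ is a filtration-preserving morphism. (3) If $C_1\le C_2\le C_3$ in $\mathcal{C}$, then $F(C_1\le C_2)\circ F(C_2\le C_3)=F(C_1\le C_3)$. Thus $F$ is a functor from $\mathcal{C}$ to $\mathrm{Fil}(K)$ sending each relation $C_1\le C_2$ to a morphism $F(C_2)\to F(C_1)$. (4) Consequently the $d$-th combinatorial PH transform $\mathrm{PH}_d\circ F$, which sends $C$ to $\mathrm{PH}_d(F(C))$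 and $C_1\le C_2$ to $(\mathrm{PH}_d(F(C_2)),\mathrm{PH}_d(F(C_1)),\bar\alpha)$, is a functor from $\mathcal{C}$ to $\mathrm{Fnc}$ (again sending $C_1\le C_2$ to a morphism from the object of $C_2$ to the object of $C_1$). In particular each of these triples is a charge-preserving morphism.
   Context: **Geometric complexes.** $K$ is a finite simplicial complex with vertex set $K^0$ and underlying space $|K|$. A function $K^0\to\mathbb{R}^{N+1}$ extends linearly (in barycentric coordinates) over each simplex to a PL map $\phi:|K|\to\mathbb{R}^{N+1}$. If $\phi$ is injective it is called a geometric complex. For $\mu\in\mathbb{S}^N=\{\mu\in\mathbb{R}^{N+1}:\|\mu\|=1\}$ the height function is $\phi_\mu:|K|\to\mathbb{R}$, $\phi_\mu(x)=\phi(x)\cdot\mu$. For a simplex $\sigma$ of $K$, $\phi_\mu(\sigma):=\sup_{x\in|\sigma|}\phi_\mu(x)$, which is the maximum of $\phi_\mu$ over the vertices of $\sigma$. **Cellulation.** Let $E$ be the set of unordered pairs of distinct vertices of $K$. For $e=(v,v')\in E$ let $H_e$ be the hyperplane through the origin orthogonal to $\phi(v)-\phi(v')$, and let $S_e=H_e\cap\mathbb{S}^N$. The two components of $\mathbb{S}^N\setminus S_e$ are denoted $S_e^+$ and $S_e^-$ (arbitrary choice). Let $\mathcal{A}=\{S_e\}_{e\in E}$. The arrangement is essential if $\bigcap_e S_e=\emptyset$. If it is not essential, adjoin finitely many additional great $(N-1)$-spheres, with chosen sides, so that the total intersection is empty, and enlarge the index set $E$ accordingly. Order $\{-,0,+\}$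 by $0<-$ and $0<+$, and order $\{-,0,+\}^E$ componentwise. Define $\Phi:\mathbb{S}^N\to\{-,0,+\}^E$ by letting $\Phi(\mu)_e$ be $-$, $0$, $+$ according to whether $\mu\in S_e^-$, $S_e$, $S_e^+$. The cells are the nonempty sets $\Phi^{-1}(f)$ for $f$ in the image of $\Phi$, and $\mathcal{C}$ is the set of cells ordered by $\Phi^{-1}(f)\le\Phi^{-1}(g)$ iff $f\le g$. (It is a known fact that these are the cells of a cell complex on $\mathbb{S}^N$ and that this order is the face relation.) **Posets.** A finite totally ordered poset $P$ has smallest element $\bot$ and largest element $\top$. A function $\alpha:P\to Q$ between such posets is bounded monotone if it is order-preserving with $\alpha(\bot)=\bot$ and $\alpha(\top)=\top$. $\mathrm{Int}(P)$ is the set of nonempty intervals $[a,b]$, $a\le b$ in $P$, ordered by $[a,b]\preceq[c,d]$ iff $a\le c$ and $b\le d$. A bounded monotone $\alpha$ induces $\bar\alpha:\mathrm{Int}(P)\to\mathrm{Int}(Q)$, $\bar\alpha([a,b])=[\alpha(a),\alpha(b)]$. **Filtrations.** $\Delta K$ is the poset of subcomplexes of $K$ under inclusion. A $P$-filtration of $K$ ($P$ finite, totally ordered) is an order-preserving map $F:P\to\Delta K$ with $F(\top)=K$. A filtration-preserving morphism from $F:P\to\Delta K$ to $G:Q\to\Delta K$ is a triple $(F,G,\alpha)$ with $\alpha:P\to Q$ bounded monotone such that for all $a\in Q$, $G(a)=F(a^\star)$, where $a^\star=\max\alpha^{-1}[\bot,a]$. Composition is $(G,H,\beta)\circ(F,G,\alpha)=(F,H,\beta\circ\alpha)$.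 $\mathrm{Fil}(K)$ is the resulting category, over all finite totally ordered $P$. **Filtration of a direction.** For $\mu\in\mathbb{S}^N$, write $v\sim_\mu v'$ for $v,v'\in K^0$ if $\phi_\mu(v)=\phi_\mu(v')$, with classes $[v]_\mu$. $P_\mu$ is the set $K^0/{\sim_\mu}$ together with one additional element $\top$, ordered by $[v]_\mu\le[v']_\mu$ iff $\phi_\mu(v)\le\phi_\mu(v')$, with $\top$ strictly above all classes. $F_\mu([v]_\mu):=\{\sigma\in K:\phi_\mu(\sigma)\le\phi_\mu(v)\}$ and $F_\mu(\top):=K$. **Integral functions.** $\mathrm{Fnc}$ is the category whose objects are functions $\sigma:\mathrm{Int}(P)\to\mathbb{Z}$ over finite totally ordered posets $P$. A morphism (charge-preserving morphism) from $\sigma:\mathrm{Int}(P)\to\mathbb{Z}$ to $\tau:\mathrm{Int}(Q)\to\mathbb{Z}$ is a triple $(\sigma,\tau,\bar\alpha)$, with $\bar\alpha$ induced by a bounded monotone $\alpha:P\to Q$, such that $\tau(I)=\sum_{J\in\bar\alpha^{-1}(I)}\sigma(J)$ for all $I\in\mathrm{Int}(Q)$ (the empty sum is $0$). Composition is composition of the maps $\bar\alpha$. **Persistent homology.** Fix a field $k$ and use (unreduced) simplicial chains over $k$. For a filtration $F:P\to\Delta K$ define $\mathrm{BD}_d(F):\mathrm{Int}(P)\to\mathbb{Z}$ as follows. For $b\ne\top$, $\mathrm{BD}_d(F)[a,b]$ is the dimension of the space of $d$-cycles of $F(a)$ that are $d$-boundaries in $F(b)$. For $b=\top$, $\mathrm{BD}_d(F)[a,\top]$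 is the dimension of the space of $d$-cycles of $F(a)$. The $d$-th persistence diagram $\mathrm{PH}_d(F):\mathrm{Int}(P)\to\mathbb{Z}$ is the Möbius inversion of $\mathrm{BD}_d(F)$, i.e. the unique function with $\mathrm{BD}_d(F)(J)=\sum_{I\preceq J}\mathrm{PH}_d(F)(I)$ for all $J\in\mathrm{Int}(P)$. On morphisms, $\mathrm{PH}_d(F,G,\alpha)=(\mathrm{PH}_d(F),\mathrm{PH}_d(G),\bar\alpha)$. *)

theory Defs
  imports "HOL-Analysis.Analysis" "HOL-Library.Poly_Mapping"
begin

section \<open>Geometric complexes\<close>

definition simplicial_complex :: "'v set set \<Rightarrow> bool" where
  "simplicial_complex K \<longleftrightarrow>
     (\<forall>\<sigma>\<in>K. finite \<sigma> \<and> \<sigma> \<noteq> {} \<and> (\<forall>\<tau>. \<tau> \<subseteq> \<sigma> \<and> \<tau> \<noteq> {} \<longrightarrow> \<tau> \<in> K))"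

definition vertices :: "'v set set \<Rightarrow> 'v set" where
  "vertices K = \<Union>K"

definition subcomplexes :: "'v set set \<Rightarrow> 'v set set set" where
  "subcomplexes K = {L. L \<subseteq> K \<and> simplicial_complex L}"

text \<open>Points of the underlying space are given by their barycentric coordinates.\<close>

definition support :: "('v \<Rightarrow> real) \<Rightarrow> 'v set" where
  "support x = {v. x v \<noteq> 0}"

definition underlying_space :: "'v set set \<Rightarrow> ('v \<Rightarrow> real) set" where
  "underlying_space K = {x. (\<forall>v. 0 \<le> x v) \<and> support x \<in> K \<and> (\<Sum>v\<in>support x. x v) = 1}"

definition closed_simplex :: "'v set set \<Rightarrow> 'v set \<Rightarrow> ('v \<Rightarrow> real) set" where
  "closed_simplex K \<sigma> = {x \<in> underlying_space K. support x \<subseteq> \<sigma>}"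

definition pl_map :: "('v \<Rightarrow> 'a::real_vector) \<Rightarrow> ('v \<Rightarrow> real) \<Rightarrow> 'a" where
  "pl_map \<phi> x = (\<Sum>v\<in>support x. x v *\<^sub>R \<phi> v)"

text \<open>The value of the PL extension at (the point given by) a vertex \<open>v\<close> is \<open>\<phi> v\<close>; below it is
  always written this way.\<close>

lemma pl_map_vertex: "pl_map \<phi> (\<lambda>w. if w = v then 1 else 0) = \<phi> v"
proof -
  have "support (\<lambda>w. if w = v then 1 else 0) = {v}"
    by (auto simp: support_def)
  then show ?thesis by (simp add: pl_map_def)
qed

definition geometric_complex :: "'v set set \<Rightarrow> ('v \<Rightarrow> 'a::euclidean_space) \<Rightarrow> bool" where
  "geometric_complex K \<phi> \<longleftrightarrow>
     finite K \<and> simplicial_complex K \<and> inj_on (pl_map \<phi>) (underlying_space K)"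

definition height :: "('v \<Rightarrow> 'a::euclidean_space) \<Rightarrow> 'a \<Rightarrow> ('v \<Rightarrow> real) \<Rightarrow> real" where
  "height \<phi> \<mu> x = pl_map \<phi> x \<bullet> \<mu>"

definition vertex_height :: "('v \<Rightarrow> 'a::euclidean_space) \<Rightarrow> 'a \<Rightarrow> 'v \<Rightarrow> real" where
  "vertex_height \<phi> \<mu> v = \<phi> v \<bullet> \<mu>"

definition simplex_height ::
    "'v set set \<Rightarrow> ('v \<Rightarrow> 'a::euclidean_space) \<Rightarrow> 'a \<Rightarrow> 'v set \<Rightarrow> real" where
  "simplex_height K \<phi> \<mu> \<sigma> = (SUP x\<in>closed_simplex K \<sigma>. height \<phi> \<mu> x)"


section \<open>The induced cellulation of the sphere\<close>

datatype sign = Neg | Zero | Pos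

instantiation sign :: order
begin

definition less_eq_sign :: "sign \<Rightarrow> sign \<Rightarrow> bool" where
  "x \<le> y \<longleftrightarrow> x = y \<or> x = Zero"

definition less_sign :: "sign \<Rightarrow> sign \<Rightarrow> bool" where
  "x < y \<longleftrightarrow> x = Zero \<and> y \<noteq> Zero"

instance
  by standard (auto simp: less_eq_sign_def less_sign_def)

end

text \<open>Indexed great subspheres of the unit sphere with a chosen side for each of the two signs.\<close>

record ('i, 'a) arrangement =
  Index :: "'i set"
  Sph :: "'i \<Rightarrow> 'a set"
  Minus :: "'i \<Rightarrow> 'a set"
  Plus :: "'i \<Rightarrow> 'a set"

abbreviation unit_sphere :: "'a::euclidean_space set" where
  "unit_sphere \<equiv> sphere 0 1"

definition vertex_pairs :: "'v set set \<Rightarrow> 'v set set" where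
  "vertex_pairs K = {{v, w} | v w. v \<in> vertices K \<and> w \<in> vertices K \<and> v \<noteq> w}"

definition pair_sphere :: "('v \<Rightarrow> 'a::euclidean_space) \<Rightarrow> 'v set \<Rightarrow> 'a set" where
  "pair_sphere \<phi> e = {\<mu> \<in> unit_sphere. \<forall>v\<in>e. \<forall>w\<in>e. (\<phi> v - \<phi> w) \<bullet> \<mu> = 0}"

definition great_sphere :: "'a::euclidean_space set \<Rightarrow> bool" where
  "great_sphere S \<longleftrightarrow> (\<exists>u. u \<noteq> 0 \<and> S = {\<mu> \<in> unit_sphere. u \<bullet> \<mu> = 0})"

text \<open>The index \<open>Inl e\<close> belongs to the pair \<open>e\<close>; the indices \<open>Inr j\<close>, \<open>j \<in> J\<close>, belong to the
  additional great spheres, which are only present if the spheres of the pairs have a common point.\<close>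

definition induced_arrangement ::
    "'v set set \<Rightarrow> ('v \<Rightarrow> 'a::euclidean_space) \<Rightarrow> ('v set + 'j, 'a) arrangement \<Rightarrow> bool" where
  "induced_arrangement K \<phi> A \<longleftrightarrow>
     (\<exists>J. finite J \<and> Index A = Inl ` vertex_pairs K \<union> Inr ` J \<and>
        (\<forall>e\<in>vertex_pairs K. Sph A (Inl e) = pair_sphere \<phi> e) \<and>
        (\<forall>j\<in>J. great_sphere (Sph A (Inr j))) \<and>
        (unit_sphere \<inter> (\<Inter>e\<in>vertex_pairs K. pair_sphere \<phi> e) = {} \<longrightarrow> J = {})) \<and>
     unit_sphere \<inter> (\<Inter>i\<in>Index A. Sph A i) = {} \<and>
     (\<forall>i\<in>Index A. Minus A i \<noteq> Plus A i \<and>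
        components (unit_sphere - Sph A i) = {Minus A i, Plus A i})"

definition sign_vector :: "('i, 'a) arrangement \<Rightarrow> 'a \<Rightarrow> 'i \<Rightarrow> sign" where
  "sign_vector A \<mu> =
     (\<lambda>i\<in>Index A. if \<mu> \<in> Minus A i then Neg else if \<mu> \<in> Sph A i then Zero else Pos)"

definition cell :: "('i, 'a::euclidean_space) arrangement \<Rightarrow> ('i \<Rightarrow> sign) \<Rightarrow> 'a set" where
  "cell A f = {\<mu> \<in> unit_sphere. sign_vector A \<mu> = f}"

definition cells :: "('i, 'a::euclidean_space) arrangement \<Rightarrow> 'a set set" where
  "cells A = cell A ` (sign_vector A ` unit_sphere)"

definition cell_le :: "('i, 'a::euclidean_space) arrangement \<Rightarrow> 'a set \<Rightarrow> 'a set \<Rightarrow> bool" where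
  "cell_le A C D \<longleftrightarrow>
     (\<exists>f\<in>sign_vector A ` unit_sphere. \<exists>g\<in>sign_vector A ` unit_sphere.
        C = cell A f \<and> D = cell A g \<and> (\<forall>i\<in>Index A. f i \<le> g i))"


section \<open>Finite totally ordered posets\<close>

text \<open>A poset is represented by its (reflexive) order relation \<open>P\<close>; its underlying set is
  \<open>Field P\<close>. Functions on posets, and on sets of intervals, are extensional, so that equality of
  functions on a poset is equality in HOL.\<close>

definition finite_total_poset :: "'p rel \<Rightarrow> bool" where
  "finite_total_poset P \<longleftrightarrow> Linear_order P \<and> finite (Field P) \<and> Field P \<noteq> {}"

definition greatest_in :: "'p rel \<Rightarrow> 'p set \<Rightarrow> 'p" where
  "greatest_in P X = (THE m. m \<in> X \<and> (\<forall>x\<in>X. (x, m) \<in> P))"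

definition top_of :: "'p rel \<Rightarrow> 'p" where
  "top_of P = greatest_in P (Field P)"

definition bot_of :: "'p rel \<Rightarrow> 'p" where
  "bot_of P = greatest_in (P\<inverse>) (Field P)"

definition bounded_monotone :: "'p rel \<Rightarrow> 'q rel \<Rightarrow> ('p \<Rightarrow> 'q) \<Rightarrow> bool" where
  "bounded_monotone P Q \<alpha> \<longleftrightarrow>
     \<alpha> \<in> Field P \<rightarrow>\<^sub>E Field Q \<and>
     monotone_on (Field P) (\<lambda>x y. (x, y) \<in> P) (\<lambda>x y. (x, y) \<in> Q) \<alpha> \<and>
     \<alpha> (bot_of P) = bot_of Q \<and> \<alpha> (top_of P) = top_of Q"

text \<open>The interval \<open>[a, b]\<close> is represented by the pair of its endpoints.\<close>

definition intervals :: "'p rel \<Rightarrow> ('p \<times> 'p) set" where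
  "intervals P = {(a, b). a \<in> Field P \<and> b \<in> Field P \<and> (a, b) \<in> P}"

definition interval_le :: "'p rel \<Rightarrow> 'p \<times> 'p \<Rightarrow> 'p \<times> 'p \<Rightarrow> bool" where
  "interval_le P I J \<longleftrightarrow> (fst I, fst J) \<in> P \<and> (snd I, snd J) \<in> P"

definition interval_map :: "'p rel \<Rightarrow> ('p \<Rightarrow> 'q) \<Rightarrow> 'p \<times> 'p \<Rightarrow> 'q \<times> 'q" where
  "interval_map P \<alpha> = (\<lambda>I\<in>intervals P. (\<alpha> (fst I), \<alpha> (snd I)))"

definition star :: "'p rel \<Rightarrow> 'q rel \<Rightarrow> ('p \<Rightarrow> 'q) \<Rightarrow> 'q \<Rightarrow> 'p" where
  "star P Q \<alpha> a =
     greatest_in P {x \<in> Field P. (bot_of Q, \<alpha> x) \<in> Q \<and> (\<alpha> x, a) \<in> Q}"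


section \<open>Categories and functors\<close>

record ('o, 'm) cat =
  Obj :: "'o set"
  Arr :: "'m set"
  Dom :: "'m \<Rightarrow> 'o"
  Cod :: "'m \<Rightarrow> 'o"
  Ident :: "'o \<Rightarrow> 'm"
  Comp :: "'m \<Rightarrow> 'm \<Rightarrow> 'm"

locale category =
  fixes C :: "('o, 'm) cat"
  assumes dom_in: "f \<in> Arr C \<Longrightarrow> Dom C f \<in> Obj C"
    and cod_in: "f \<in> Arr C \<Longrightarrow> Cod C f \<in> Obj C"
    and ident_in: "x \<in> Obj C \<Longrightarrow> Ident C x \<in> Arr C"
    and dom_ident: "x \<in> Obj C \<Longrightarrow> Dom C (Ident C x) = x"
    and cod_ident: "x \<in> Obj C \<Longrightarrow> Cod C (Ident C x) = x"
    and comp_in: "\<lbrakk>f \<in> Arr C; g \<in> Arr C; Cod C f = Dom C g\<rbrakk> \<Longrightarrow> Comp C g f \<in> Arr C"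
    and dom_comp: "\<lbrakk>f \<in> Arr C; g \<in> Arr C; Cod C f = Dom C g\<rbrakk> \<Longrightarrow> Dom C (Comp C g f) = Dom C f"
    and cod_comp: "\<lbrakk>f \<in> Arr C; g \<in> Arr C; Cod C f = Dom C g\<rbrakk> \<Longrightarrow> Cod C (Comp C g f) = Cod C g"
    and comp_ident_right: "f \<in> Arr C \<Longrightarrow> Comp C f (Ident C (Dom C f)) = f"
    and comp_ident_left: "f \<in> Arr C \<Longrightarrow> Comp C (Ident C (Cod C f)) f = f"
    and comp_assoc:
      "\<lbrakk>f \<in> Arr C; g \<in> Arr C; h \<in> Arr C; Cod C f = Dom C g; Cod C g = Dom C h\<rbrakk>
       \<Longrightarrow> Comp C (Comp C h g) f = Comp C h (Comp C g f)"

locale cat_functor = A: category A + B: category B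
  for A :: "('o, 'm) cat" and B :: "('o2, 'm2) cat" +
  fixes Fo :: "'o \<Rightarrow> 'o2" and Fa :: "'m \<Rightarrow> 'm2"
  assumes obj_in: "x \<in> Obj A \<Longrightarrow> Fo x \<in> Obj B"
    and arr_in: "f \<in> Arr A \<Longrightarrow> Fa f \<in> Arr B"
    and dom_arr: "f \<in> Arr A \<Longrightarrow> Dom B (Fa f) = Fo (Dom A f)"
    and cod_arr: "f \<in> Arr A \<Longrightarrow> Cod B (Fa f) = Fo (Cod A f)"
    and map_ident: "x \<in> Obj A \<Longrightarrow> Fa (Ident A x) = Ident B (Fo x)"
    and map_comp: "\<lbrakk>f \<in> Arr A; g \<in> Arr A; Cod A f = Dom A g\<rbrakk>
       \<Longrightarrow> Fa (Comp A g f) = Comp B (Fa g) (Fa f)"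

definition op_cat :: "('o, 'm) cat \<Rightarrow> ('o, 'm) cat" where
  "op_cat C = \<lparr>Obj = Obj C, Arr = Arr C, Dom = Cod C, Cod = Dom C, Ident = Ident C,
     Comp = (\<lambda>g f. Comp C f g)\<rparr>"

definition poset_cat :: "'o set \<Rightarrow> ('o \<Rightarrow> 'o \<Rightarrow> bool) \<Rightarrow> ('o, 'o \<times> 'o) cat" where
  "poset_cat X le = \<lparr>Obj = X, Arr = {(x, y). x \<in> X \<and> y \<in> X \<and> le x y}, Dom = fst, Cod = snd,
     Ident = (\<lambda>x. (x, x)), Comp = (\<lambda>g f. (fst f, snd g))\<rparr>"


section \<open>Filtrations and integral functions\<close>

type_synonym ('p, 'v) filtration = "'p rel \<times> ('p \<Rightarrow> 'v set set)"
type_synonym ('p, 'v) filtration_arrow =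
  "('p, 'v) filtration \<times> ('p, 'v) filtration \<times> ('p \<Rightarrow> 'p)"

definition is_filtration :: "'v set set \<Rightarrow> ('p, 'v) filtration \<Rightarrow> bool" where
  "is_filtration K X \<longleftrightarrow> (case X of (P, F) \<Rightarrow>
     finite_total_poset P \<and> F \<in> Field P \<rightarrow>\<^sub>E subcomplexes K \<and>
     monotone_on (Field P) (\<lambda>x y. (x, y) \<in> P) (\<subseteq>) F \<and> F (top_of P) = K)"

definition filtration_preserving ::
    "'v set set \<Rightarrow> ('p, 'v) filtration_arrow \<Rightarrow> bool" where
  "filtration_preserving K m \<longleftrightarrow> (case m of ((P, F), (Q, G), \<alpha>) \<Rightarrow>
     is_filtration K (P, F) \<and> is_filtration K (Q, G) \<and> bounded_monotone P Q \<alpha> \<and>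
     (\<forall>a\<in>Field Q. G a = F (star P Q \<alpha> a)))"

definition Fil ::
    "'v set set \<Rightarrow> (('p, 'v) filtration, ('p, 'v) filtration_arrow) cat" where
  "Fil K = \<lparr>Obj = {X. is_filtration K X}, Arr = {m. filtration_preserving K m},
     Dom = fst, Cod = (\<lambda>m. fst (snd m)),
     Ident = (\<lambda>X. (X, X, \<lambda>x\<in>Field (fst X). x)),
     Comp = (\<lambda>(_, H, \<beta>) (F, _, \<alpha>). (F, H, compose (Field (fst F)) \<beta> \<alpha>))\<rparr>"

type_synonym 'p integral_function = "'p rel \<times> ('p \<times> 'p \<Rightarrow> int)"
type_synonym 'p integral_arrow =
  "'p integral_function \<times> 'p integral_function \<times> ('p \<times> 'p \<Rightarrow> 'p \<times> 'p)"

definition is_integral_function :: "'p integral_function \<Rightarrow> bool" where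
  "is_integral_function X \<longleftrightarrow> (case X of (P, \<sigma>) \<Rightarrow>
     finite_total_poset P \<and> \<sigma> \<in> extensional (intervals P))"

definition charge_preserving :: "'p integral_arrow \<Rightarrow> bool" where
  "charge_preserving m \<longleftrightarrow> (case m of ((P, \<sigma>), (Q, \<tau>), \<beta>) \<Rightarrow>
     is_integral_function (P, \<sigma>) \<and> is_integral_function (Q, \<tau>) \<and>
     (\<exists>\<alpha>. bounded_monotone P Q \<alpha> \<and> \<beta> = interval_map P \<alpha>) \<and>
     (\<forall>I\<in>intervals Q. \<tau> I = (\<Sum>J\<in>{J\<in>intervals P. \<beta> J = I}. \<sigma> J)))"

definition Fnc :: "('p integral_function, 'p integral_arrow) cat" where
  "Fnc = \<lparr>Obj = {X. is_integral_function X}, Arr = {m. charge_preserving m},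
     Dom = fst, Cod = (\<lambda>m. fst (snd m)),
     Ident = (\<lambda>X. (X, X, \<lambda>I\<in>intervals (fst X). I)),
     Comp = (\<lambda>(_, \<rho>, \<beta>) (\<sigma>, _, \<alpha>). (\<sigma>, \<rho>, compose (intervals (fst \<sigma>)) \<beta> \<alpha>))\<rparr>"


section \<open>The filtration of a direction\<close>

definition height_class ::
    "'v set set \<Rightarrow> ('v \<Rightarrow> 'a::euclidean_space) \<Rightarrow> 'a \<Rightarrow> 'v \<Rightarrow> 'v set" where
  "height_class K \<phi> \<mu> v = {w \<in> vertices K. vertex_height \<phi> \<mu> w = vertex_height \<phi> \<mu> v}"

text \<open>The additional top element is \<open>None\<close>.\<close>

definition dir_poset ::
    "'v set set \<Rightarrow> ('v \<Rightarrow> 'a::euclidean_space) \<Rightarrow> 'a \<Rightarrow> 'v set option rel" where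
  "dir_poset K \<phi> \<mu> =
     {(Some (height_class K \<phi> \<mu> v), Some (height_class K \<phi> \<mu> w)) | v w.
        v \<in> vertices K \<and> w \<in> vertices K \<and> vertex_height \<phi> \<mu> v \<le> vertex_height \<phi> \<mu> w} \<union>
     {(Some (height_class K \<phi> \<mu> v), None) | v. v \<in> vertices K} \<union> {(None, None)}"

definition dir_map ::
    "'v set set \<Rightarrow> ('v \<Rightarrow> 'a::euclidean_space) \<Rightarrow> 'a \<Rightarrow> 'v set option \<Rightarrow> 'v set set" where
  "dir_map K \<phi> \<mu> = (\<lambda>p\<in>Field (dir_poset K \<phi> \<mu>).
     case p of None \<Rightarrow> K
     | Some c \<Rightarrow> {\<sigma> \<in> K. \<exists>v\<in>c. simplex_height K \<phi> \<mu> \<sigma> \<le> vertex_height \<phi> \<mu> v})"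

definition dir_filtration ::
    "'v set set \<Rightarrow> ('v \<Rightarrow> 'a::euclidean_space) \<Rightarrow> 'a \<Rightarrow> ('v set option, 'v) filtration" where
  "dir_filtration K \<phi> \<mu> = (dir_poset K \<phi> \<mu>, dir_map K \<phi> \<mu>)"

text \<open>\<open>\<alpha>\<close> is a function on \<open>P\<^sub>\<mu>\<close> obeying the assignment \<open>[v]\<^sub>\<mu> \<mapsto> [v]\<^sub>\<nu>\<close>, \<open>\<top> \<mapsto> \<top>\<close>; the assignment is
  well defined iff there is exactly one such \<open>\<alpha>\<close>.\<close>

definition class_map ::
    "'v set set \<Rightarrow> ('v \<Rightarrow> 'a::euclidean_space) \<Rightarrow> 'a \<Rightarrow> 'a \<Rightarrow>
     ('v set option \<Rightarrow> 'v set option) \<Rightarrow> bool" where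
  "class_map K \<phi> \<mu> \<nu> \<alpha> \<longleftrightarrow> \<alpha> \<in> extensional (Field (dir_poset K \<phi> \<mu>)) \<and>
     (\<forall>v\<in>vertices K. \<alpha> (Some (height_class K \<phi> \<mu> v)) = Some (height_class K \<phi> \<nu> v)) \<and>
     \<alpha> None = None"

definition cell_filtration ::
    "'v set set \<Rightarrow> ('v \<Rightarrow> 'a::euclidean_space) \<Rightarrow> 'a set \<Rightarrow> ('v set option, 'v) filtration" where
  "cell_filtration K \<phi> C = (THE X. \<forall>\<mu>\<in>C. X = dir_filtration K \<phi> \<mu>)"

definition cell_arrow ::
    "'v set set \<Rightarrow> ('v \<Rightarrow> 'a::euclidean_space) \<Rightarrow> 'a set \<times> 'a set \<Rightarrow>
     ('v set option, 'v) filtration_arrow" where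
  "cell_arrow K \<phi> = (\<lambda>(C\<^sub>1, C\<^sub>2). (cell_filtration K \<phi> C\<^sub>2, cell_filtration K \<phi> C\<^sub>1,
     THE \<alpha>. \<forall>\<nu>\<in>C\<^sub>1. \<forall>\<mu>\<in>C\<^sub>2. class_map K \<phi> \<mu> \<nu> \<alpha>))"


section \<open>Persistent homology\<close>

text \<open>Simplicial chains over the field are formal linear combinations of simplices, oriented by
  a linear order \<open>r\<close> of the vertices: the boundary of \<open>v\<^sub>0 < \<dots> < v\<^sub>d\<close> is the sum of the faces opposite
  to \<open>v\<^sub>i\<close> with sign \<open>(-1)\<^sup>i\<close>, and the boundary of a vertex is zero.\<close>

type_synonym ('v, 'k) chain = "'v set \<Rightarrow>\<^sub>0 'k"

definition chain_scale :: "'k::field \<Rightarrow> ('v, 'k) chain \<Rightarrow> ('v, 'k) chain" where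
  "chain_scale a c = Poly_Mapping.map ((*) a) c"

lemma lookup_chain_scale:
  "Poly_Mapping.lookup (chain_scale a c) \<sigma> = a * Poly_Mapping.lookup c \<sigma>"
  by (simp add: chain_scale_def Poly_Mapping.map.rep_eq when_def)

global_interpretation chain: vector_space chain_scale
  by standard (auto intro!: poly_mapping_eqI simp: lookup_chain_scale lookup_add algebra_simps)

definition chains :: "nat \<Rightarrow> 'v set set \<Rightarrow> ('v, 'k::field) chain set" where
  "chains d L = {c. Poly_Mapping.keys c \<subseteq> {\<sigma> \<in> L. card \<sigma> = Suc d}}"

definition boundary :: "'v rel \<Rightarrow> nat \<Rightarrow> ('v, 'k::field) chain \<Rightarrow> ('v, 'k) chain" where
  "boundary r d c = (if d = 0 then 0 else
     (\<Sum>\<sigma>\<in>Poly_Mapping.keys c. \<Sum>v\<in>\<sigma>.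
        Poly_Mapping.single (\<sigma> - {v})
          ((-1) ^ card {u \<in> \<sigma>. u \<noteq> v \<and> (u, v) \<in> r} * Poly_Mapping.lookup c \<sigma>)))"

definition cycles :: "'v rel \<Rightarrow> nat \<Rightarrow> 'v set set \<Rightarrow> ('v, 'k::field) chain set" where
  "cycles r d L = {c \<in> chains d L. boundary r d c = 0}"

definition boundaries :: "'v rel \<Rightarrow> nat \<Rightarrow> 'v set set \<Rightarrow> ('v, 'k::field) chain set" where
  "boundaries r d L = boundary r (Suc d) ` chains (Suc d) L"

text \<open>The first argument is the coefficient field.\<close>

definition BD ::
    "'k::field itself \<Rightarrow> 'v rel \<Rightarrow> nat \<Rightarrow> ('p, 'v) filtration \<Rightarrow> 'p \<times> 'p \<Rightarrow> int" where
  "BD _ r d X = (case X of (P, F) \<Rightarrow> \<lambda>I\<in>intervals P. case I of (a, b) \<Rightarrow>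
     int (chain.dim
       (if b = top_of P then (cycles r d (F a) :: ('v, 'k) chain set)
        else cycles r d (F a) \<inter> boundaries r d (F b))))"

definition PH ::
    "'k::field itself \<Rightarrow> 'v rel \<Rightarrow> nat \<Rightarrow> ('p, 'v) filtration \<Rightarrow> 'p integral_function" where
  "PH k r d X = (fst X, THE \<sigma>. \<sigma> \<in> extensional (intervals (fst X)) \<and>
     (\<forall>J\<in>intervals (fst X).
        BD k r d X J = (\<Sum>I\<in>{I\<in>intervals (fst X). interval_le (fst X) I J}. \<sigma> I)))"

definition PH_arrow ::
    "'k::field itself \<Rightarrow> 'v rel \<Rightarrow> nat \<Rightarrow> ('p, 'v) filtration_arrow \<Rightarrow> 'p integral_arrow" where
  "PH_arrow k r d = (\<lambda>(X, Y, \<alpha>). (PH k r d X, PH k r d Y, interval_map (fst X) \<alpha>))"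

end

theory Submission
  imports Defs
begin

text \<open>
  Only the order in which a direction lists the vertices matters. The sign vector of a direction
  \<open>\<mu>\<close> records, for every pair of vertices, which one is higher, or that they are level
  (\<open>sign_vector_pair\<close>). If \<open>\<nu>\<close> lies in a face of the cell of \<open>\<mu>\<close>, strict comparisons may
  become equalities but are never reversed, so \<open>v\<close> being at most as high as \<open>w\<close> for \<open>\<mu>\<close> implies the same
  for \<open>\<nu>\<close> (\<open>coarsens_if_sign_vector_le\<close>). The poset and the filtration of a direction are built
  from this preorder alone, since a simplex is as high as its highest vertex
  (\<open>simplex_height_le_iff\<close>); within one cell they are therefore constant, and along a face relation
  \<open>[v]\<^sub>\<mu> \<mapsto> [v]\<^sub>\<nu>\<close> is a well-defined bounded monotone map \<open>\<alpha>\<close>.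

  A bounded monotone map between finite total orders has the right adjoint \<open>a \<mapsto> a\<^sup>\<star>\<close>
  (\<open>star_props\<close>). With it, the sublevel subcomplex of \<open>[w]\<^sub>\<nu>\<close> is that of its adjoint image in
  the poset of \<open>\<mu>\<close> (\<open>filtration_preserving_class_map\<close>), and adjoints compose, which makes
  the filtrations a category and the cells a contravariant diagram in it. Functoriality on the cells
  follows because a map obeying the assignment on classes is unique.

  Persistent homology is a functor from filtrations to integral functions for the same reason. If
  \<open>G a = F a\<^sup>\<star>\<close>, the birth-death functions agree, \<open>BD\<^sub>G [a, b] = BD\<^sub>F [a\<^sup>\<star>, b\<^sup>\<star>]\<close>, because
  they measure the same spaces (\<open>BD_star\<close>). The intervals sent below \<open>[a, b]\<close> by \<open>\<alpha>\<close> are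
  those below \<open>[a\<^sup>\<star>, b\<^sup>\<star>]\<close>, so the push-forward of the diagram of \<open>F\<close> has the cumulative sums
  \<open>BD\<^sub>G\<close>, and uniqueness of Moebius inversion identifies it with the diagram of \<open>G\<close>
  (\<open>charge_preserving_PH_arrow\<close>). The transform is the composite of the two functors.
\<close>

section \<open>Finite totally ordered sets and their bounded monotone maps\<close>

lemma finite_total_posetD:
  assumes "finite_total_poset P"
  shows "finite (Field P)" "Field P \<noteq> {}" "antisym P" "trans P"
    and "x \<in> Field P \<Longrightarrow> (x, x) \<in> P"
    and "x \<in> Field P \<Longrightarrow> y \<in> Field P \<Longrightarrow> (x, y) \<in> P \<or> (y, x) \<in> P"
proof -
  from assms show "finite (Field P)" "Field P \<noteq> {}" "antisym P" "trans P"
    and refl: "x \<in> Field P \<Longrightarrow> (x, x) \<in> P" for x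
    by (auto simp: finite_total_poset_def order_on_defs refl_on_def)
  show "x \<in> Field P \<Longrightarrow> y \<in> Field P \<Longrightarrow> (x, y) \<in> P \<or> (y, x) \<in> P"
    using assms refl by (cases "x = y") (auto simp: finite_total_poset_def order_on_defs total_on_def)
qed

lemma finite_total_poset_converse: "finite_total_poset P \<Longrightarrow> finite_total_poset (P\<inverse>)"
  by (simp add: finite_total_poset_def)

lemma greatest_in_eq:
  assumes "antisym P" "m \<in> X" "\<And>x. x \<in> X \<Longrightarrow> (x, m) \<in> P"
  shows "greatest_in P X = m"
  unfolding greatest_in_def using assms by (intro the_equality) (auto dest: antisymD)

text \<open>In a finite total order every nonempty subset has a greatest element, so the description operator
  defining the bottom, the top and the element \<open>a\<^sup>\<star>\<close> always hits a value.\<close>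

lemma greatest_in_exists:
  assumes P: "finite_total_poset P" and X: "X \<subseteq> Field P" "X \<noteq> {}"
  shows "\<exists>m\<in>X. \<forall>x\<in>X. (x, m) \<in> P"
proof -
  have "finite X"
    using X finite_total_posetD(1)[OF P] by (rule_tac finite_subset) auto
  then show ?thesis using X(2,1)
  proof (induction X rule: finite_ne_induct)
    case (singleton x)
    then show ?case using finite_total_posetD(5)[OF P] by auto
  next
    case (insert x X)
    then obtain m where m: "m \<in> X" "\<forall>y\<in>X. (y, m) \<in> P" by auto
    have x: "x \<in> Field P" "m \<in> Field P" using insert.prems m(1) by auto
    from finite_total_posetD(6)[OF P this] show ?case
    proof
      assume "(x, m) \<in> P"
      then show ?thesis using m by auto
    next
      assume "(m, x) \<in> P"
      then have "\<forall>y\<in>X. (y, x) \<in> P"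
        using m(2) finite_total_posetD(4)[OF P] by (meson transD)
      then show ?thesis using finite_total_posetD(5)[OF P x(1)] by auto
    qed
  qed
qed

lemma greatest_in_props:
  assumes "finite_total_poset P" "X \<subseteq> Field P" "X \<noteq> {}"
  shows "greatest_in P X \<in> X" and "x \<in> X \<Longrightarrow> (x, greatest_in P X) \<in> P"
proof -
  obtain m where m: "m \<in> X" "\<forall>x\<in>X. (x, m) \<in> P"
    using greatest_in_exists[OF assms] by auto
  then have "greatest_in P X = m"
    using finite_total_posetD(3)[OF assms(1)] by (auto intro: greatest_in_eq)
  then show "greatest_in P X \<in> X" and "x \<in> X \<Longrightarrow> (x, greatest_in P X) \<in> P"
    using m by auto
qed

lemma top_of_props:
  assumes "finite_total_poset P"
  shows "top_of P \<in> Field P" and "x \<in> Field P \<Longrightarrow> (x, top_of P) \<in> P"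
  unfolding top_of_def
  using greatest_in_props[OF assms subset_refl] finite_total_posetD(2)[OF assms] by auto

lemma bot_of_props:
  assumes "finite_total_poset P"
  shows "bot_of P \<in> Field P" and "x \<in> Field P \<Longrightarrow> (bot_of P, x) \<in> P"
  unfolding bot_of_def
  using greatest_in_props[OF finite_total_poset_converse[OF assms], of "Field P"]
    finite_total_posetD(2)[OF assms] by auto

lemma bounded_monotoneD:
  assumes "bounded_monotone P Q \<alpha>"
  shows "x \<in> Field P \<Longrightarrow> \<alpha> x \<in> Field Q" "(x, y) \<in> P \<Longrightarrow> (\<alpha> x, \<alpha> y) \<in> Q"
    "\<alpha> (bot_of P) = bot_of Q" "\<alpha> (top_of P) = top_of Q" "\<alpha> \<in> extensional (Field P)"
  using assms by (auto simp: bounded_monotone_def monotone_on_def PiE_def intro: FieldI1 FieldI2)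

text \<open>The element \<open>a\<^sup>\<star>\<close> is the right adjoint of \<open>\<alpha>\<close>: \<open>x \<le> a\<^sup>\<star> \<longleftrightarrow> \<alpha> x \<le> a\<close>. The set whose maximum defines
  \<open>a\<^sup>\<star>\<close> is nonempty because \<open>\<alpha>\<close> preserves the bottom. The adjunction alone
  determines \<open>a\<^sup>\<star>\<close>.\<close>

lemma star_props:
  assumes P: "finite_total_poset P" and Q: "finite_total_poset Q"
    and \<alpha>: "bounded_monotone P Q \<alpha>" and a: "a \<in> Field Q"
  shows "star P Q \<alpha> a \<in> Field P"
    and "x \<in> Field P \<Longrightarrow> (x, star P Q \<alpha> a) \<in> P \<longleftrightarrow> (\<alpha> x, a) \<in> Q"
proof -
  let ?X = "{x \<in> Field P. (bot_of Q, \<alpha> x) \<in> Q \<and> (\<alpha> x, a) \<in> Q}"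
  have "bot_of P \<in> ?X"
    using bot_of_props[OF P] bot_of_props[OF Q] a by (auto simp: bounded_monotoneD(3)[OF \<alpha>])
  then have X: "?X \<subseteq> Field P" "?X \<noteq> {}" by auto
  note g = greatest_in_props[OF P X, folded star_def]
  show "star P Q \<alpha> a \<in> Field P" using g(1) by simp
  assume x: "x \<in> Field P"
  show "(x, star P Q \<alpha> a) \<in> P \<longleftrightarrow> (\<alpha> x, a) \<in> Q"
  proof
    assume "(x, star P Q \<alpha> a) \<in> P"
    then have "(\<alpha> x, \<alpha> (star P Q \<alpha> a)) \<in> Q" by (rule bounded_monotoneD(2)[OF \<alpha>])
    then show "(\<alpha> x, a) \<in> Q"
      using g(1) finite_total_posetD(4)[OF Q] by (auto dest: transD)
  next
    assume "(\<alpha> x, a) \<in> Q"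
    moreover have "(bot_of Q, \<alpha> x) \<in> Q"
      using bot_of_props(2)[OF Q] bounded_monotoneD(1)[OF \<alpha> x] by simp
    ultimately show "(x, star P Q \<alpha> a) \<in> P" using x g(2)[of x] by simp
  qed
qed

text \<open>Right adjoints are unique, by antisymmetry; this is how values of \<open>a\<^sup>\<star>\<close> are computed.\<close>

lemma star_eqI:
  assumes P: "finite_total_poset P" and Q: "finite_total_poset Q"
    and \<alpha>: "bounded_monotone P Q \<alpha>" and a: "a \<in> Field Q" and m: "m \<in> Field P"
    and adj: "\<And>x. x \<in> Field P \<Longrightarrow> (x, m) \<in> P \<longleftrightarrow> (\<alpha> x, a) \<in> Q"
  shows "star P Q \<alpha> a = m"
proof (rule antisymD[OF finite_total_posetD(3)[OF P]])
  note s = star_props[OF P Q \<alpha> a]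
  show "(star P Q \<alpha> a, m) \<in> P"
    using s(2)[OF s(1)] adj[OF s(1)] finite_total_posetD(5)[OF P s(1)] by simp
  show "(m, star P Q \<alpha> a) \<in> P"
    using s(2)[OF m] adj[OF m] finite_total_posetD(5)[OF P m] by simp
qed

text \<open>Preservation of the top is what makes the case split \<open>b = \<top>\<close> in the birth-death function
  compatible with filtration-preserving morphisms.\<close>

lemma star_eq_top_iff:
  assumes P: "finite_total_poset P" and Q: "finite_total_poset Q"
    and \<alpha>: "bounded_monotone P Q \<alpha>" and a: "a \<in> Field Q"
  shows "star P Q \<alpha> a = top_of P \<longleftrightarrow> a = top_of Q"
proof -
  note s = star_props[OF P Q \<alpha> a] and tP = top_of_props[OF P] and tQ = top_of_props[OF Q]
  have "star P Q \<alpha> a = top_of P \<longleftrightarrow> (top_of P, star P Q \<alpha> a) \<in> P"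
    using tP(1) tP(2)[OF s(1)] finite_total_posetD(3,5)[OF P] by (metis antisymD)
  also have "\<dots> \<longleftrightarrow> (top_of Q, a) \<in> Q"
    using s(2)[OF tP(1)] by (simp add: bounded_monotoneD(4)[OF \<alpha>])
  also have "\<dots> \<longleftrightarrow> a = top_of Q"
    using tQ(1) tQ(2)[OF a] finite_total_posetD(3,5)[OF Q] by (metis antisymD)
  finally show ?thesis .
qed

lemma bounded_monotone_id:
  "finite_total_poset P \<Longrightarrow> bounded_monotone P P (\<lambda>x\<in>Field P. x)"
  using top_of_props(1) bot_of_props(1)
  by (fastforce simp: bounded_monotone_def monotone_on_def)

lemma bounded_monotone_compose:
  assumes P: "finite_total_poset P"
    and \<alpha>: "bounded_monotone P Q \<alpha>" and \<beta>: "bounded_monotone Q R \<beta>"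
  shows "bounded_monotone P R (compose (Field P) \<beta> \<alpha>)"
proof -
  have "compose (Field P) \<beta> \<alpha> (bot_of P) = bot_of R" "compose (Field P) \<beta> \<alpha> (top_of P) = top_of R"
    using top_of_props(1)[OF P] bot_of_props(1)[OF P] bounded_monotoneD(3,4)[OF \<alpha>]
      bounded_monotoneD(3,4)[OF \<beta>] by (auto simp: compose_eq)
  moreover have "compose (Field P) \<beta> \<alpha> \<in> Field P \<rightarrow>\<^sub>E Field R"
    using bounded_monotoneD(1)[OF \<alpha>] bounded_monotoneD(1)[OF \<beta>] by (auto simp: compose_def)
  moreover have "monotone_on (Field P) (\<lambda>x y. (x, y) \<in> P) (\<lambda>x y. (x, y) \<in> R) (compose (Field P) \<beta> \<alpha>)"
    using bounded_monotoneD(2)[OF \<alpha>] bounded_monotoneD(2)[OF \<beta>]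
    by (auto simp: monotone_on_def compose_eq)
  ultimately show ?thesis by (simp add: bounded_monotone_def)
qed

text \<open>The right adjoint of a composition is the composition of the right adjoints; hence
  filtration-preserving morphisms compose.\<close>

lemma star_compose:
  assumes P: "finite_total_poset P" and Q: "finite_total_poset Q" and R: "finite_total_poset R"
    and \<alpha>: "bounded_monotone P Q \<alpha>" and \<beta>: "bounded_monotone Q R \<beta>" and a: "a \<in> Field R"
  shows "star P R (compose (Field P) \<beta> \<alpha>) a = star P Q \<alpha> (star Q R \<beta> a)"
proof (rule star_eqI[OF P R bounded_monotone_compose[OF P \<alpha> \<beta>] a])
  note b = star_props[OF Q R \<beta> a]
  note c = star_props[OF P Q \<alpha> b(1)]
  show "star P Q \<alpha> (star Q R \<beta> a) \<in> Field P" by (rule c)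
  fix x assume "x \<in> Field P"
  then show "(x, star P Q \<alpha> (star Q R \<beta> a)) \<in> P \<longleftrightarrow> (compose (Field P) \<beta> \<alpha> x, a) \<in> R"
    using bounded_monotoneD(1)[OF \<alpha>] by (simp add: b(2) c(2) compose_eq)
qed

section \<open>The categories of filtrations and of integral functions\<close>

lemma filtration_preserving_id:
  assumes "is_filtration K X"
  shows "filtration_preserving K (X, X, \<lambda>x\<in>Field (fst X). x)"
proof -
  obtain P F where X: "X = (P, F)" by (cases X)
  have P: "finite_total_poset P" using assms by (simp add: X is_filtration_def)
  have "star P P (\<lambda>x\<in>Field P. x) a = a" if "a \<in> Field P" for a
    using that by (intro star_eqI[OF P P bounded_monotone_id[OF P]]) auto
  then show ?thesis
    using assms bounded_monotone_id[OF P] by (simp add: X filtration_preserving_def)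
qed

lemma filtration_preserving_compose:
  assumes "filtration_preserving K (X, Y, \<alpha>)" "filtration_preserving K (Y, Z, \<beta>)"
  shows "filtration_preserving K (X, Z, compose (Field (fst X)) \<beta> \<alpha>)"
proof -
  obtain P F Q G R H where X: "X = (P, F)" "Y = (Q, G)" "Z = (R, H)"
    by (cases X, cases Y, cases Z)
  have P: "finite_total_poset P" "finite_total_poset Q" "finite_total_poset R"
    and \<alpha>: "bounded_monotone P Q \<alpha>" and \<beta>: "bounded_monotone Q R \<beta>"
    and G: "\<And>a. a \<in> Field Q \<Longrightarrow> G a = F (star P Q \<alpha> a)"
    and H: "\<And>a. a \<in> Field R \<Longrightarrow> H a = G (star Q R \<beta> a)"
    using assms by (auto simp: X filtration_preserving_def is_filtration_def)
  have "H a = F (star P R (compose (Field P) \<beta> \<alpha>) a)" if a: "a \<in> Field R" for a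
    using star_compose[OF P \<alpha> \<beta> a] H[OF a] G[OF star_props(1)[OF P(2,3) \<beta> a]] by simp
  then show ?thesis
    using assms bounded_monotone_compose[OF P(1) \<alpha> \<beta>]
    by (auto simp: X filtration_preserving_def)
qed

lemma filtration_preserving_map:
  "filtration_preserving K (X, Y, \<alpha>) \<Longrightarrow> \<alpha> \<in> Field (fst X) \<rightarrow>\<^sub>E Field (fst Y)"
  by (auto simp: filtration_preserving_def bounded_monotone_def)

lemma category_Fil:
  fixes K :: "'v set set"
  shows "category (Fil K :: (('p, 'v) filtration, ('p, 'v) filtration_arrow) cat)"
proof
  fix f g h :: "('p, 'v) filtration_arrow"
  assume fg: "f \<in> Arr (Fil K)" "g \<in> Arr (Fil K)" "Cod (Fil K) f = Dom (Fil K) g"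
  then obtain X Y Z \<alpha> \<beta> where fg_eq: "f = (X, Y, \<alpha>)" "g = (Y, Z, \<beta>)"
    by (cases f, cases g) (auto simp: Fil_def)
  have arr: "filtration_preserving K (X, Y, \<alpha>)" "filtration_preserving K (Y, Z, \<beta>)"
    using fg fg_eq by (auto simp: Fil_def)
  from filtration_preserving_compose[OF this]
  show "Comp (Fil K) g f \<in> Arr (Fil K)" by (simp add: fg_eq Fil_def)
  assume h: "h \<in> Arr (Fil K)" "Cod (Fil K) g = Dom (Fil K) h"
  then obtain W \<gamma> where h_eq: "h = (Z, W, \<gamma>)"
    by (cases h) (auto simp: Fil_def fg_eq)
  have "\<alpha> \<in> Field (fst X) \<rightarrow> Field (fst Y)"
    using filtration_preserving_map[OF arr(1)] by auto
  from compose_assoc[OF this, of \<gamma> \<beta>]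
  show "Comp (Fil K) (Comp (Fil K) h g) f = Comp (Fil K) h (Comp (Fil K) g f)"
    by (simp add: Fil_def fg_eq h_eq)
next
  fix f :: "('p, 'v) filtration_arrow"
  assume "f \<in> Arr (Fil K)"
  then obtain X Y \<alpha> where f: "f = (X, Y, \<alpha>)" "filtration_preserving K (X, Y, \<alpha>)"
    by (cases f) (auto simp: Fil_def)
  have \<alpha>: "\<alpha> \<in> Field (fst X) \<rightarrow> Field (fst Y)" "\<alpha> \<in> extensional (Field (fst X))"
    using filtration_preserving_map[OF f(2)] by (auto simp: PiE_def)
  show "Comp (Fil K) f (Ident (Fil K) (Dom (Fil K) f)) = f"
    using compose_Id[OF \<alpha>] by (simp add: Fil_def f)
  show "Comp (Fil K) (Ident (Fil K) (Cod (Fil K) f)) f = f"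
    using Id_compose[OF \<alpha>] by (simp add: Fil_def f)
qed (auto simp: Fil_def filtration_preserving_id split: prod.splits, auto simp: filtration_preserving_def)

lemma interval_map_id: "interval_map P (\<lambda>x\<in>Field P. x) = (\<lambda>I\<in>intervals P. I)"
  by (auto simp: interval_map_def intervals_def fun_eq_iff)

lemma interval_map_in:
  assumes "bounded_monotone P Q \<alpha>" "I \<in> intervals P"
  shows "interval_map P \<alpha> I \<in> intervals Q"
  using assms bounded_monotoneD(1,2)[OF assms(1)] by (auto simp: interval_map_def intervals_def)

lemma interval_map_compose:
  assumes "bounded_monotone P Q \<alpha>"
  shows "interval_map P (compose (Field P) \<beta> \<alpha>)
    = compose (intervals P) (interval_map Q \<beta>) (interval_map P \<alpha>)"
  using bounded_monotoneD(1,2)[OF assms]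
  by (auto simp: interval_map_def compose_def fun_eq_iff intervals_def)

lemma finite_intervals: "finite_total_poset P \<Longrightarrow> finite (intervals P)"
  by (rule finite_subset[of _ "Field P \<times> Field P"])
     (auto simp: intervals_def finite_total_posetD(1))

lemma charge_preserving_id:
  assumes "is_integral_function X"
  shows "charge_preserving (X, X, \<lambda>I\<in>intervals (fst X). I)"
proof -
  obtain P \<sigma> where X: "X = (P, \<sigma>)" by (cases X)
  have P: "finite_total_poset P" using assms by (simp add: X is_integral_function_def)
  have "{J \<in> intervals P. (\<lambda>I\<in>intervals P. I) J = I} = {I}" if "I \<in> intervals P" for I
    using that by auto
  then show ?thesis
    using assms bounded_monotone_id[OF P] interval_map_id[of P]
    by (auto simp: X charge_preserving_def)
qed

text \<open>The fibre of the composite map over \<open>I\<close> is partitioned by the fibres of the first map over the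
  points of the fibre of the second.\<close>

lemma charge_preserving_compose:
  assumes "charge_preserving (X, Y, \<beta>)" "charge_preserving (Y, Z, \<gamma>)"
  shows "charge_preserving (X, Z, compose (intervals (fst X)) \<gamma> \<beta>)"
proof -
  obtain P \<sigma> Q \<tau> R \<rho> where X: "X = (P, \<sigma>)" "Y = (Q, \<tau>)" "Z = (R, \<rho>)"
    by (cases X, cases Y, cases Z)
  obtain \<alpha> \<alpha>' where P: "finite_total_poset P" "finite_total_poset Q"
    and \<alpha>: "bounded_monotone P Q \<alpha>" "\<beta> = interval_map P \<alpha>"
    and \<alpha>': "bounded_monotone Q R \<alpha>'" "\<gamma> = interval_map Q \<alpha>'"
    and \<tau>: "\<And>I. I \<in> intervals Q \<Longrightarrow> \<tau> I = (\<Sum>J\<in>{J\<in>intervals P. \<beta> J = I}. \<sigma> J)"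
    and \<rho>: "\<And>I. I \<in> intervals R \<Longrightarrow> \<rho> I = (\<Sum>J\<in>{J\<in>intervals Q. \<gamma> J = I}. \<tau> J)"
    using assms by (auto simp: X charge_preserving_def is_integral_function_def)
  have "\<rho> I = (\<Sum>J\<in>{J\<in>intervals P. compose (intervals P) \<gamma> \<beta> J = I}. \<sigma> J)"
    if I: "I \<in> intervals R" for I
  proof -
    have "\<rho> I = (\<Sum>J\<in>{J\<in>intervals Q. \<gamma> J = I}.
        \<Sum>J'\<in>{J'\<in>{J'\<in>intervals P. \<gamma> (\<beta> J') = I}. \<beta> J' = J}. \<sigma> J')"
      unfolding \<rho>[OF I] by (intro sum.cong refl) (auto simp: \<tau> intro!: sum.cong)
    also have "\<dots> = (\<Sum>J'\<in>{J'\<in>intervals P. \<gamma> (\<beta> J') = I}. \<sigma> J')"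
      using finite_intervals[OF P(1)] finite_intervals[OF P(2)] interval_map_in[OF \<alpha>(1)]
      by (intro sum.group) (auto simp: \<alpha>(2))
    also have "\<dots> = (\<Sum>J\<in>{J\<in>intervals P. compose (intervals P) \<gamma> \<beta> J = I}. \<sigma> J)"
      by (intro sum.cong) (auto simp: compose_eq)
    finally show ?thesis .
  qed
  moreover have "compose (intervals P) \<gamma> \<beta> = interval_map P (compose (Field P) \<alpha>' \<alpha>)"
    by (simp only: interval_map_compose[OF \<alpha>(1)] \<alpha>(2) \<alpha>'(2))
  ultimately show ?thesis
    using assms bounded_monotone_compose[OF P(1) \<alpha>(1) \<alpha>'(1)]
    by (auto simp: X charge_preserving_def)
qed

lemma charge_preserving_map:
  assumes "charge_preserving (X, Y, \<beta>)"
  shows "\<beta> \<in> intervals (fst X) \<rightarrow>\<^sub>E intervals (fst Y)"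
  using assms interval_map_in by (fastforce simp: charge_preserving_def interval_map_def)

lemma category_Fnc: "category Fnc"
proof
  fix f g h :: "'p integral_arrow"
  assume fg: "f \<in> Arr Fnc" "g \<in> Arr Fnc" "Cod Fnc f = Dom Fnc g"
  then obtain X Y Z \<alpha> \<beta> where fg_eq: "f = (X, Y, \<alpha>)" "g = (Y, Z, \<beta>)"
    by (cases f, cases g) (auto simp: Fnc_def)
  have arr: "charge_preserving (X, Y, \<alpha>)" "charge_preserving (Y, Z, \<beta>)"
    using fg fg_eq by (auto simp: Fnc_def)
  from charge_preserving_compose[OF this]
  show "Comp Fnc g f \<in> Arr Fnc" by (simp add: fg_eq Fnc_def)
  assume h: "h \<in> Arr Fnc" "Cod Fnc g = Dom Fnc h"
  then obtain W \<gamma> where h_eq: "h = (Z, W, \<gamma>)"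
    by (cases h) (auto simp: Fnc_def fg_eq)
  have "\<alpha> \<in> intervals (fst X) \<rightarrow> intervals (fst Y)"
    using charge_preserving_map[OF arr(1)] by auto
  from compose_assoc[OF this, of \<gamma> \<beta>]
  show "Comp Fnc (Comp Fnc h g) f = Comp Fnc h (Comp Fnc g f)"
    by (simp add: Fnc_def fg_eq h_eq)
next
  fix f :: "'p integral_arrow"
  assume "f \<in> Arr Fnc"
  then obtain X Y \<alpha> where f: "f = (X, Y, \<alpha>)" "charge_preserving (X, Y, \<alpha>)"
    by (cases f) (auto simp: Fnc_def)
  have \<alpha>: "\<alpha> \<in> intervals (fst X) \<rightarrow> intervals (fst Y)" "\<alpha> \<in> extensional (intervals (fst X))"
    using charge_preserving_map[OF f(2)] by (auto simp: PiE_def)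
  show "Comp Fnc f (Ident Fnc (Dom Fnc f)) = f"
    using compose_Id[OF \<alpha>] by (simp add: Fnc_def f)
  show "Comp Fnc (Ident Fnc (Cod Fnc f)) f = f"
    using Id_compose[OF \<alpha>] by (simp add: Fnc_def f)
qed (auto simp: Fnc_def charge_preserving_id split: prod.splits, auto simp: charge_preserving_def)

lemma cat_functor_compose:
  assumes "cat_functor A B Fo Fa" "cat_functor B C Go Ga"
  shows "cat_functor A C (Go \<circ> Fo) (Ga \<circ> Fa)"
proof -
  interpret F: cat_functor A B Fo Fa by fact
  interpret G: cat_functor B C Go Ga by fact
  show ?thesis
    by unfold_locales
      (auto simp: F.obj_in G.obj_in F.arr_in G.arr_in F.dom_arr G.dom_arr F.cod_arr G.cod_arr
        F.map_ident G.map_ident F.map_comp G.map_comp)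
qed

lemma category_op:
  assumes "category C" shows "category (op_cat C)"
proof -
  interpret C: category C by fact
  show ?thesis
    by unfold_locales
      (auto simp: op_cat_def C.dom_in C.cod_in C.ident_in C.dom_ident C.cod_ident C.comp_in
        C.dom_comp C.cod_comp C.comp_ident_left C.comp_ident_right C.comp_assoc)
qed

lemma category_poset:
  assumes "\<And>x. x \<in> X \<Longrightarrow> le x x"
    and "\<And>x y z. \<lbrakk>x \<in> X; y \<in> X; z \<in> X; le x y; le y z\<rbrakk> \<Longrightarrow> le x z"
  shows "category (poset_cat X le)"
  by unfold_locales (auto simp: poset_cat_def intro: assms)

section \<open>Moebius inversion and functoriality of persistence diagrams\<close>

text \<open>Moebius inversion over a finite poset. Removing a maximal element \<open>m\<close> affects no other down-set, so
  a solution on \<open>X - {m}\<close> extends in exactly one way: the equation at \<open>m\<close> determines the value at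
  \<open>m\<close>.\<close>

lemma moebius_inversion:
  fixes g :: "'a \<Rightarrow> int"
  assumes "finite X"
    and refl: "\<And>x. x \<in> X \<Longrightarrow> le x x"
    and antisym: "\<And>x y. \<lbrakk>x \<in> X; y \<in> X; le x y; le y x\<rbrakk> \<Longrightarrow> x = y"
    and trans: "\<And>x y z. \<lbrakk>x \<in> X; y \<in> X; z \<in> X; le x y; le y z\<rbrakk> \<Longrightarrow> le x z"
  shows "\<exists>!\<sigma>. \<sigma> \<in> extensional X \<and> (\<forall>J\<in>X. g J = (\<Sum>I\<in>{I\<in>X. le I J}. \<sigma> I))"
  using assms
proof (induction X rule: finite_psubset_induct)
  case (psubset X)
  show ?case
  proof (cases "X = {}")
    case True
    then show ?thesis by auto
  next
    case False
    \<comment> \<open>An element with the largest down-set is maximal.\<close>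
    obtain m where m: "m \<in> X" "\<And>y. y \<in> X \<Longrightarrow> le m y \<Longrightarrow> y = m"
    proof -
      let ?n = "\<lambda>x. card {y\<in>X. le y x}"
      have "Max (?n ` X) \<in> ?n ` X" by (rule Max_in) (simp_all add: False psubset.hyps)
      then obtain m where m: "m \<in> X" "?n m = Max (?n ` X)" by (elim imageE) simp
      have max: "?n y \<le> ?n m" if "y \<in> X" for y
        unfolding m(2) using \<open>finite X\<close> that by (intro Max_ge) auto
      have "y = m" if y: "y \<in> X" "le m y" for y
      proof (rule ccontr)
        assume "y \<noteq> m"
        then have "\<not> le y m" using y m(1) psubset.prems(2) by blast
        then have "{x\<in>X. le x m} \<subset> {x\<in>X. le x y}"
          using y m(1) psubset.prems(1,3) by blast
        then have "?n m < ?n y" using \<open>finite X\<close> by (intro psubset_card_mono) auto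
        then show False using max[OF y(1)] by simp
      qed
      then show ?thesis using m(1) that by blast
    qed
    let ?Y = "X - {m}"
    have "?Y \<subset> X" using m(1) by auto
    from psubset.IH[OF this] psubset.prems
    obtain \<rho> where \<rho>: "\<rho> \<in> extensional ?Y" "\<And>J. J \<in> ?Y \<Longrightarrow> g J = (\<Sum>I\<in>{I\<in>?Y. le I J}. \<rho> I)"
      and uniq: "\<And>\<tau>. \<lbrakk>\<tau> \<in> extensional ?Y; \<And>J. J \<in> ?Y \<Longrightarrow> g J = (\<Sum>I\<in>{I\<in>?Y. le I J}. \<tau> I)\<rbrakk> \<Longrightarrow> \<tau> = \<rho>"
      by (smt (verit, ccfv_threshold) DiffD1)
    have below: "{I\<in>X. le I J} = {I\<in>?Y. le I J}" if "J \<in> ?Y" for J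
      using m that by auto
    have below_m: "{I\<in>X. le I m} = insert m {I\<in>?Y. le I m}"
      using m(1) psubset.prems(1) by auto
    have sum_m: "(\<Sum>I\<in>{I\<in>X. le I m}. \<tau> I) = \<tau> m + (\<Sum>I\<in>{I\<in>?Y. le I m}. \<tau> I)" for \<tau> :: "'a \<Rightarrow> int"
      unfolding below_m using \<open>finite X\<close> by (subst sum.insert) auto
    define \<sigma> where "\<sigma> = \<rho>(m := g m - (\<Sum>I\<in>{I\<in>?Y. le I m}. \<rho> I))"
    have \<sigma>_eq: "(\<Sum>I\<in>{I\<in>?Y. le I J}. \<sigma> I) = (\<Sum>I\<in>{I\<in>?Y. le I J}. \<rho> I)" for J
      by (intro sum.cong) (auto simp: \<sigma>_def)
    show ?thesis
    proof (intro ex1I conjI ballI)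
      show "\<sigma> \<in> extensional X"
        using \<rho>(1) m(1) by (auto simp: \<sigma>_def extensional_def)
      show "g J = (\<Sum>I\<in>{I\<in>X. le I J}. \<sigma> I)" if "J \<in> X" for J
      proof (cases "J = m")
        case True
        then show ?thesis unfolding True sum_m \<sigma>_eq by (simp add: \<sigma>_def)
      next
        case False
        then have J: "J \<in> ?Y" using that by auto
        show ?thesis unfolding below[OF J] \<sigma>_eq by (rule \<rho>(2)[OF J])
      qed
    next
      fix \<tau>
      assume \<tau>: "\<tau> \<in> extensional X \<and> (\<forall>J\<in>X. g J = (\<Sum>I\<in>{I\<in>X. le I J}. \<tau> I))"
      have restr: "(\<Sum>I\<in>{I\<in>?Y. le I J}. restrict \<tau> ?Y I) = (\<Sum>I\<in>{I\<in>?Y. le I J}. \<tau> I)" for J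
        by (intro sum.cong) auto
      have "restrict \<tau> ?Y = \<rho>"
      proof (rule uniq)
        fix J assume J: "J \<in> ?Y"
        then show "g J = (\<Sum>I\<in>{I\<in>?Y. le I J}. restrict \<tau> ?Y I)"
          using \<tau> below[OF J] unfolding restr by auto
      qed auto
      then have on_Y: "\<tau> I = \<rho> I" if "I \<in> ?Y" for I
        using that by (metis restrict_apply)
      have "g m = \<tau> m + (\<Sum>I\<in>{I\<in>?Y. le I m}. \<tau> I)" using \<tau> m(1) sum_m by auto
      moreover have "(\<Sum>I\<in>{I\<in>?Y. le I m}. \<tau> I) = (\<Sum>I\<in>{I\<in>?Y. le I m}. \<rho> I)"
        by (intro sum.cong) (auto simp: on_Y)
      ultimately have "\<tau> m = \<sigma> m" by (simp add: \<sigma>_def)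
      show "\<tau> = \<sigma>"
      proof
        fix x
        consider "x = m" | "x \<in> ?Y" | "x \<notin> X" by auto
        then show "\<tau> x = \<sigma> x"
        proof cases
          case 3
          then show ?thesis using \<tau> \<rho>(1) m(1) by (auto simp: \<sigma>_def extensional_def)
        qed (use \<open>\<tau> m = \<sigma> m\<close> on_Y in \<open>auto simp: \<sigma>_def\<close>)
      qed
    qed
  qed
qed

lemma moebius_inversion_intervals:
  fixes g :: "'p \<times> 'p \<Rightarrow> int"
  assumes P: "finite_total_poset P"
  shows "\<exists>!\<sigma>. \<sigma> \<in> extensional (intervals P) \<and>
    (\<forall>J\<in>intervals P. g J = (\<Sum>I\<in>{I\<in>intervals P. interval_le P I J}. \<sigma> I))"
proof (rule moebius_inversion[OF finite_intervals[OF P]])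
  show "interval_le P I I" if "I \<in> intervals P" for I
    using that finite_total_posetD(5)[OF P] by (auto simp: interval_le_def intervals_def)
  show "I = J" if "interval_le P I J" "interval_le P J I" for I J
    using that finite_total_posetD(3)[OF P]
    by (auto simp: interval_le_def prod_eq_iff dest: antisymD)
  show "interval_le P I H" if "interval_le P I J" "interval_le P J H" for I J H
    using that finite_total_posetD(4)[OF P] by (auto simp: interval_le_def dest: transD)
qed

lemma fst_PH: "fst (PH k r d X) = fst X"
  by (simp add: PH_def)

text \<open>Existence and uniqueness of the Moebius inverse turn the description operator in the definition of the
  persistence diagram into a characterisation.\<close>

lemma PH_moebius:
  assumes "is_filtration K X"
  shows "snd (PH k r d X) \<in> extensional (intervals (fst X))"
    and "J \<in> intervals (fst X) \<Longrightarrow>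
      BD k r d X J = (\<Sum>I\<in>{I\<in>intervals (fst X). interval_le (fst X) I J}. snd (PH k r d X) I)"
    and "\<lbrakk>\<tau> \<in> extensional (intervals (fst X)); \<And>J. J \<in> intervals (fst X) \<Longrightarrow>
      BD k r d X J = (\<Sum>I\<in>{I\<in>intervals (fst X). interval_le (fst X) I J}. \<tau> I)\<rbrakk>
      \<Longrightarrow> snd (PH k r d X) = \<tau>"
proof -
  have P: "finite_total_poset (fst X)" using assms by (auto simp: is_filtration_def)
  note ex1 = moebius_inversion_intervals[OF P, of "BD k r d X"]
  show "snd (PH k r d X) \<in> extensional (intervals (fst X))"
    using theI'[OF ex1] unfolding PH_def snd_conv by (rule conjunct1)
  show "J \<in> intervals (fst X) \<Longrightarrow>
      BD k r d X J = (\<Sum>I\<in>{I\<in>intervals (fst X). interval_le (fst X) I J}. snd (PH k r d X) I)"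
    using theI'[OF ex1] unfolding PH_def snd_conv by blast
  show "\<lbrakk>\<tau> \<in> extensional (intervals (fst X)); \<And>J. J \<in> intervals (fst X) \<Longrightarrow>
      BD k r d X J = (\<Sum>I\<in>{I\<in>intervals (fst X). interval_le (fst X) I J}. \<tau> I)\<rbrakk>
      \<Longrightarrow> snd (PH k r d X) = \<tau>"
    unfolding PH_def snd_conv by (rule the1_equality[OF ex1]) blast
qed

lemma is_integral_function_PH:
  assumes "is_filtration K X"
  shows "is_integral_function (PH k r d X)"
  using PH_moebius(1)[OF assms, of k r d] fst_PH[of k r d X] assms
  by (cases "PH k r d X") (auto simp: is_integral_function_def is_filtration_def)

text \<open>The filtrations satisfy \<open>G a = F a\<^sup>\<star>\<close>, so the birth-death function of \<open>G\<close> at \<open>[a, b]\<close> is the dimension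
  of literally the same space of chains as that of \<open>F\<close> at \<open>[a\<^sup>\<star>, b\<^sup>\<star>]\<close>.\<close>

lemma BD_star:
  assumes "filtration_preserving K ((P, F), (Q, G), \<alpha>)" and I: "(a, b) \<in> intervals Q"
  shows "(star P Q \<alpha> a, star P Q \<alpha> b) \<in> intervals P"
    and "BD k r d (Q, G) (a, b) = BD k r d (P, F) (star P Q \<alpha> a, star P Q \<alpha> b)"
proof -
  have P: "finite_total_poset P" and Q: "finite_total_poset Q" and \<alpha>: "bounded_monotone P Q \<alpha>"
    and G: "\<And>a. a \<in> Field Q \<Longrightarrow> G a = F (star P Q \<alpha> a)"
    using assms by (auto simp: filtration_preserving_def is_filtration_def)
  have ab: "a \<in> Field Q" "b \<in> Field Q" "(a, b) \<in> Q" using I by (auto simp: intervals_def)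
  note sa = star_props[OF P Q \<alpha> ab(1)] and sb = star_props[OF P Q \<alpha> ab(2)]
  have "(\<alpha> (star P Q \<alpha> a), a) \<in> Q"
    using sa(2)[OF sa(1)] finite_total_posetD(5)[OF P sa(1)] by simp
  then have "(\<alpha> (star P Q \<alpha> a), b) \<in> Q"
    using ab(3) finite_total_posetD(4)[OF Q] by (auto dest: transD)
  then show int: "(star P Q \<alpha> a, star P Q \<alpha> b) \<in> intervals P"
    using sa(1) sb(1) sb(2)[OF sa(1)] by (simp add: intervals_def)
  show "BD k r d (Q, G) (a, b) = BD k r d (P, F) (star P Q \<alpha> a, star P Q \<alpha> b)"
    using I int G[OF ab(1)] G[OF ab(2)] star_eq_top_iff[OF P Q \<alpha> ab(2)] by (simp add: BD_def)
qed

text \<open>The push-forward \<open>\<rho>\<close> of the diagram of the source along \<open>\<alpha>\<close> satisfies the equations that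
  characterise the diagram of the target: summing \<open>\<rho>\<close> below \<open>[a, b]\<close> sums the source diagram over
  the intervals that \<open>\<alpha>\<close> sends below \<open>[a, b]\<close>, which by adjunction are the intervals below
  \<open>[a\<^sup>\<star>, b\<^sup>\<star>]\<close>, and that sum is a birth-death value by \<open>BD_star\<close>.\<close>

lemma charge_preserving_PH_arrow:
  assumes "filtration_preserving K (X, Y, \<alpha>)"
  shows "charge_preserving (PH_arrow k r d (X, Y, \<alpha>))"
proof -
  obtain P F Q G where X: "X = (P, F)" and Y: "Y = (Q, G)" by (cases X, cases Y)
  have fil: "is_filtration K X" "is_filtration K Y"
    and P: "finite_total_poset P" and Q: "finite_total_poset Q" and \<alpha>: "bounded_monotone P Q \<alpha>"
    using assms by (auto simp: X Y filtration_preserving_def is_filtration_def)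
  define \<sigma> where "\<sigma> = snd (PH k r d X)"
  define \<tau> where "\<tau> = snd (PH k r d Y)"
  have PH: "PH k r d X = (P, \<sigma>)" "PH k r d Y = (Q, \<tau>)"
    using fst_PH[of k r d X] fst_PH[of k r d Y] by (simp_all add: X Y \<sigma>_def \<tau>_def prod_eq_iff)
  define \<beta> where "\<beta> = interval_map P \<alpha>"
  define \<rho> where "\<rho> = (\<lambda>I\<in>intervals Q. \<Sum>J\<in>{J\<in>intervals P. \<beta> J = I}. \<sigma> J)"
  have "\<tau> = \<rho>"
    unfolding \<tau>_def
  proof (rule PH_moebius(3)[OF fil(2)])
    show "\<rho> \<in> extensional (intervals (fst Y))" by (simp add: \<rho>_def Y)
    fix J assume "J \<in> intervals (fst Y)"
    then have J: "J \<in> intervals Q" by (simp add: Y)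
    obtain a b where ab: "J = (a, b)" by (cases J)
    have field: "a \<in> Field Q" "b \<in> Field Q" using J by (auto simp: ab intervals_def)
    note star = BD_star[OF assms[unfolded X Y] J[unfolded ab]]
    have iff: "interval_le P I (star P Q \<alpha> a, star P Q \<alpha> b) \<longleftrightarrow> interval_le Q (\<beta> I) J"
      if "I \<in> intervals P" for I
      using that star_props(2)[OF P Q \<alpha> field(1)] star_props(2)[OF P Q \<alpha> field(2)]
      by (auto simp: interval_le_def \<beta>_def interval_map_def ab intervals_def)
    have "BD k r d Y J = BD k r d X (star P Q \<alpha> a, star P Q \<alpha> b)"
      unfolding X Y ab by (rule star(2))
    also have "\<dots> = (\<Sum>I\<in>{I\<in>intervals P. interval_le P I (star P Q \<alpha> a, star P Q \<alpha> b)}. \<sigma> I)"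
      using PH_moebius(2)[OF fil(1), of _ k r d] star(1) by (simp add: X \<sigma>_def)
    also have "\<dots> = (\<Sum>I\<in>{I\<in>intervals P. interval_le Q (\<beta> I) J}. \<sigma> I)"
      using iff by (intro sum.cong) auto
    also have "\<dots> = (\<Sum>I\<in>{I\<in>intervals Q. interval_le Q I J}.
        \<Sum>I'\<in>{I'\<in>{I'\<in>intervals P. interval_le Q (\<beta> I') J}. \<beta> I' = I}. \<sigma> I')"
      using finite_intervals[OF P] finite_intervals[OF Q] interval_map_in[OF \<alpha>]
      by (intro sum.group[symmetric]) (auto simp: \<beta>_def)
    also have "\<dots> = (\<Sum>I\<in>{I\<in>intervals Q. interval_le Q I J}. \<rho> I)"
      by (intro sum.cong refl) (auto simp: \<rho>_def intro!: sum.cong)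
    finally show "BD k r d Y J
        = (\<Sum>I\<in>{I\<in>intervals (fst Y). interval_le (fst Y) I J}. \<rho> I)"
      by (simp add: Y)
  qed
  then have "\<tau> I = (\<Sum>J\<in>{J\<in>intervals P. \<beta> J = I}. \<sigma> J)" if "I \<in> intervals Q" for I
    using that by (auto simp: \<rho>_def)
  then show ?thesis
    using is_integral_function_PH[OF fil(1), of k r d] is_integral_function_PH[OF fil(2), of k r d] \<alpha>
    unfolding PH_arrow_def prod.case PH charge_preserving_def by (auto simp: X \<beta>_def)
qed

lemma cat_functor_PH: "cat_functor (Fil K) Fnc (PH k r d) (PH_arrow k r d)"
proof -
  interpret Fil: category "Fil K" by (rule category_Fil)
  interpret Fnc: category Fnc by (rule category_Fnc)
  show ?thesis
  proof
    fix f g :: "('a, 'b) filtration_arrow"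
    assume f: "f \<in> Arr (Fil K)" and g: "g \<in> Arr (Fil K)" and fg: "Cod (Fil K) f = Dom (Fil K) g"
    obtain X Y Z \<alpha> \<beta> where eq: "f = (X, Y, \<alpha>)" "g = (Y, Z, \<beta>)"
      using fg by (cases f, cases g) (auto simp: Fil_def)
    have "bounded_monotone (fst X) (fst Y) \<alpha>"
      using f by (auto simp: eq Fil_def filtration_preserving_def)
    from interval_map_compose[OF this, of \<beta>]
    show "PH_arrow k r d (Comp (Fil K) g f) = Comp Fnc (PH_arrow k r d g) (PH_arrow k r d f)"
      by (simp add: eq Fil_def Fnc_def PH_arrow_def PH_def)
  next
    fix f :: "('a, 'b) filtration_arrow"
    assume f: "f \<in> Arr (Fil K)"
    then show "PH_arrow k r d f \<in> Arr Fnc"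
      using charge_preserving_PH_arrow by (cases f) (auto simp: Fil_def Fnc_def)
    show "Dom Fnc (PH_arrow k r d f) = PH k r d (Dom (Fil K) f)"
      and "Cod Fnc (PH_arrow k r d f) = PH k r d (Cod (Fil K) f)"
      by (cases f; simp add: Fil_def Fnc_def PH_arrow_def)+
  next
    fix X :: "('a, 'b) filtration"
    assume "X \<in> Obj (Fil K)"
    then show "PH k r d X \<in> Obj Fnc"
      using is_integral_function_PH[of K X k r d] by (simp add: Fil_def Fnc_def)
    show "PH_arrow k r d (Ident (Fil K) X) = Ident Fnc (PH k r d X)"
      by (simp add: Fil_def Fnc_def PH_arrow_def PH_def interval_map_id)
  qed
qed

section \<open>Height functions on simplices and the filtration of a direction\<close>

lemma simplicial_complex_face:
  assumes "simplicial_complex K" "\<sigma> \<in> K" "\<tau> \<subseteq> \<sigma>" "\<tau> \<noteq> {}"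
  shows "\<tau> \<in> K"
  using bspec[OF assms(1)[unfolded simplicial_complex_def] assms(2)] assms(3,4) by simp

lemma simplicial_complex_simplex:
  assumes "simplicial_complex K" "\<sigma> \<in> K"
  shows "finite \<sigma>" "\<sigma> \<noteq> {}"
  using bspec[OF assms(1)[unfolded simplicial_complex_def] assms(2)] by simp_all

lemma full_subcomplex:
  assumes "simplicial_complex K"
  shows "{\<sigma> \<in> K. \<forall>v\<in>\<sigma>. Q v} \<in> subcomplexes K"
proof -
  have "simplicial_complex {\<sigma> \<in> K. \<forall>v\<in>\<sigma>. Q v}"
    unfolding simplicial_complex_def
    using simplicial_complex_face[OF assms] simplicial_complex_simplex[OF assms] by blast
  then show ?thesis by (auto simp: subcomplexes_def)
qed

lemma height_eq: "height \<phi> \<mu> x = (\<Sum>v\<in>support x. x v * vertex_height \<phi> \<mu> v)"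
  by (simp add: height_def pl_map_def vertex_height_def inner_sum_left)

lemma vertex_point_in_closed_simplex:
  assumes "simplicial_complex K" "\<sigma> \<in> K" "v \<in> \<sigma>"
  shows "(\<lambda>w. if w = v then 1 else 0) \<in> closed_simplex K \<sigma>"
proof -
  have "{v} \<in> K"
    using assms by (auto intro: simplicial_complex_face)
  moreover have "support (\<lambda>w. if w = v then 1 else 0) = {v}"
    by (auto simp: support_def)
  ultimately show ?thesis
    using assms(3) by (simp add: closed_simplex_def underlying_space_def)
qed

lemma height_le_on_closed_simplex:
  assumes "simplicial_complex K" "x \<in> closed_simplex K \<sigma>"
    and "\<And>v. v \<in> \<sigma> \<Longrightarrow> vertex_height \<phi> \<mu> v \<le> c"
  shows "height \<phi> \<mu> x \<le> c"
proof -
  have x: "support x \<subseteq> \<sigma>" "\<And>v. 0 \<le> x v" "(\<Sum>v\<in>support x. x v) = 1"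
    using assms(2) by (auto simp: closed_simplex_def underlying_space_def)
  have "height \<phi> \<mu> x \<le> (\<Sum>v\<in>support x. x v * c)"
    unfolding height_eq using x assms(3) by (intro sum_mono mult_left_mono) auto
  then show ?thesis using x(3) by (simp add: sum_distrib_right[symmetric])
qed

text \<open>A height is a convex combination of vertex heights, and the vertices are themselves points of
  the closed simplex. Comparing with a bound avoids choosing a vertex at which the maximum is attained.\<close>

lemma simplex_height_le_iff:
  assumes K: "simplicial_complex K" and \<sigma>: "\<sigma> \<in> K"
  shows "simplex_height K \<phi> \<mu> \<sigma> \<le> c \<longleftrightarrow> (\<forall>v\<in>\<sigma>. vertex_height \<phi> \<mu> v \<le> c)"
proof -
  have fin: "finite \<sigma>" and ne: "\<sigma> \<noteq> {}" using simplicial_complex_simplex[OF K \<sigma>] .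
  have ne': "height \<phi> \<mu> ` closed_simplex K \<sigma> \<noteq> {}"
    using vertex_point_in_closed_simplex[OF K \<sigma>] ne by blast
  have bdd: "bdd_above (height \<phi> \<mu> ` closed_simplex K \<sigma>)"
  proof (rule bdd_aboveI2)
    fix x assume "x \<in> closed_simplex K \<sigma>"
    then show "height \<phi> \<mu> x \<le> Max (vertex_height \<phi> \<mu> ` \<sigma>)"
      by (rule height_le_on_closed_simplex[OF K]) (simp add: fin)
  qed
  have "simplex_height K \<phi> \<mu> \<sigma> \<le> c \<longleftrightarrow> (\<forall>x\<in>closed_simplex K \<sigma>. height \<phi> \<mu> x \<le> c)"
    unfolding simplex_height_def cSup_le_iff[OF ne' bdd] by simp
  also have "\<dots> \<longleftrightarrow> (\<forall>v\<in>\<sigma>. vertex_height \<phi> \<mu> v \<le> c)"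
  proof (intro iffI ballI)
    fix v assume le: "\<forall>x\<in>closed_simplex K \<sigma>. height \<phi> \<mu> x \<le> c" and v: "v \<in> \<sigma>"
    show "vertex_height \<phi> \<mu> v \<le> c"
      using bspec[OF le vertex_point_in_closed_simplex[OF K \<sigma> v]]
      by (simp add: height_def vertex_height_def pl_map_vertex)
  qed (rule height_le_on_closed_simplex[OF K], auto)
  finally show ?thesis .
qed

lemma height_class_eq_iff:
  assumes "v \<in> vertices K"
  shows "height_class K \<phi> \<mu> v = height_class K \<phi> \<mu> w \<longleftrightarrow> vertex_height \<phi> \<mu> v = vertex_height \<phi> \<mu> w"
  using assms by (auto simp: height_class_def)

lemma dir_poset_None: "(p, None) \<in> dir_poset K \<phi> \<mu> \<longleftrightarrow> p \<in> Field (dir_poset K \<phi> \<mu>)"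
  by (auto simp: dir_poset_def Field_def)

lemma dir_poset_from_None: "(None, p) \<in> dir_poset K \<phi> \<mu> \<longleftrightarrow> p = None"
  by (auto simp: dir_poset_def)

lemma Field_dir_poset:
  "Field (dir_poset K \<phi> \<mu>) = insert None ((\<lambda>v. Some (height_class K \<phi> \<mu> v)) ` vertices K)"
  by (auto simp: dir_poset_def Field_def)

lemma dir_poset_classes:
  assumes "v \<in> vertices K" "w \<in> vertices K"
  shows "(Some (height_class K \<phi> \<mu> v), Some (height_class K \<phi> \<mu> w)) \<in> dir_poset K \<phi> \<mu>
    \<longleftrightarrow> vertex_height \<phi> \<mu> v \<le> vertex_height \<phi> \<mu> w"
  using assms by (fastforce simp: dir_poset_def height_class_eq_iff)

lemma finite_total_poset_dir_poset:
  assumes "finite (vertices K)"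
  shows "finite_total_poset (dir_poset K \<phi> \<mu>)"
proof -
  let ?P = "dir_poset K \<phi> \<mu>"
  have elim: "p = None \<or> (\<exists>v\<in>vertices K. p = Some (height_class K \<phi> \<mu> v))" if "p \<in> Field ?P" for p
    using that by (auto simp: Field_dir_poset)
  have None: "None \<in> Field ?P" by (simp add: Field_dir_poset)
  have "refl_on (Field ?P) ?P"
    using elim None by (fastforce simp: refl_on_def dir_poset_classes dir_poset_None intro: FieldI1 FieldI2)
  moreover have "antisym ?P"
  proof (rule antisymI)
    fix p q assume pq: "(p, q) \<in> ?P" "(q, p) \<in> ?P"
    then show "p = q"
      using elim[OF FieldI1[OF pq(1)]] elim[OF FieldI2[OF pq(1)]]
      by (elim disjE bexE) (simp_all add: dir_poset_from_None dir_poset_classes height_class_eq_iff)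
  qed
  moreover have "trans ?P"
  proof (rule transI)
    fix p q s assume pq: "(p, q) \<in> ?P" "(q, s) \<in> ?P"
    then show "(p, s) \<in> ?P"
      using elim[OF FieldI1[OF pq(1)]] elim[OF FieldI2[OF pq(1)]] elim[OF FieldI2[OF pq(2)]]
        FieldI1[OF pq(1)]
      by (auto simp: dir_poset_from_None dir_poset_classes dir_poset_None)
  qed
  moreover have "total_on (Field ?P) ?P"
  proof (rule total_onI)
    fix p q assume pq: "p \<in> Field ?P" "q \<in> Field ?P"
    then show "(p, q) \<in> ?P \<or> (q, p) \<in> ?P"
      using elim[OF pq(1)] elim[OF pq(2)]
      by (auto simp: dir_poset_None dir_poset_classes)
  qed
  moreover have "finite (Field ?P)" using assms by (simp add: Field_dir_poset)
  ultimately show ?thesis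
    using None by (auto simp: finite_total_poset_def order_on_defs refl_on_def intro: FieldI1 FieldI2)
qed

lemma finite_vertices: "finite K \<Longrightarrow> simplicial_complex K \<Longrightarrow> finite (vertices K)"
  by (auto simp: vertices_def simplicial_complex_simplex)

lemma top_of_dir_poset:
  assumes "finite (vertices K)"
  shows "top_of (dir_poset K \<phi> \<mu>) = None"
  unfolding top_of_def
  using finite_total_posetD(3)[OF finite_total_poset_dir_poset[OF assms]]
  by (intro greatest_in_eq) (auto simp: dir_poset_None Field_dir_poset)

lemma bot_of_dir_poset_eq_class:
  assumes "finite (vertices K)" "v \<in> vertices K"
    and "\<And>w. w \<in> vertices K \<Longrightarrow> vertex_height \<phi> \<mu> v \<le> vertex_height \<phi> \<mu> w"
  shows "bot_of (dir_poset K \<phi> \<mu>) = Some (height_class K \<phi> \<mu> v)"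
  unfolding bot_of_def
  using finite_total_posetD(3)[OF finite_total_poset_dir_poset[OF assms(1)], of \<phi> \<mu>] assms(2,3)
  by (intro greatest_in_eq) (auto simp: Field_dir_poset dir_poset_classes dir_poset_None)

lemma dir_map_None: "dir_map K \<phi> \<mu> None = K"
  by (simp add: dir_map_def Field_dir_poset)

text \<open>The sublevel subcomplex depends on \<open>\<mu>\<close> only through the preorder that the heights induce on the
  vertices.\<close>

lemma dir_map_class:
  assumes "simplicial_complex K" "v \<in> vertices K"
  shows "dir_map K \<phi> \<mu> (Some (height_class K \<phi> \<mu> v))
    = {\<sigma> \<in> K. \<forall>w\<in>\<sigma>. vertex_height \<phi> \<mu> w \<le> vertex_height \<phi> \<mu> v}"
  using assms
  by (auto simp: dir_map_def Field_dir_poset height_class_def simplex_height_le_iff)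

lemma is_filtration_dir_filtration:
  assumes "finite K" "simplicial_complex K"
  shows "is_filtration K (dir_filtration K \<phi> \<mu>)"
proof -
  note fin = finite_vertices[OF assms]
  have sub: "dir_map K \<phi> \<mu> p \<in> subcomplexes K" if "p \<in> Field (dir_poset K \<phi> \<mu>)" for p
    using that assms(2) full_subcomplex[OF assms(2)]
    by (auto simp: Field_dir_poset dir_map_None dir_map_class) (simp add: subcomplexes_def)
  moreover have "dir_map K \<phi> \<mu> p \<subseteq> dir_map K \<phi> \<mu> q"
    if "p \<in> Field (dir_poset K \<phi> \<mu>)" "q \<in> Field (dir_poset K \<phi> \<mu>)" "(p, q) \<in> dir_poset K \<phi> \<mu>" for p q
    using that assms(2) sub[OF that(1)]
    by (fastforce simp: Field_dir_poset dir_map_None dir_map_class dir_poset_classes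
        dir_poset_from_None subcomplexes_def)
  moreover have "dir_map K \<phi> \<mu> \<in> extensional (Field (dir_poset K \<phi> \<mu>))"
    by (simp add: dir_map_def)
  ultimately show ?thesis
    using finite_total_poset_dir_poset[OF fin]
    by (simp add: is_filtration_def dir_filtration_def top_of_dir_poset[OF fin] dir_map_None
        PiE_def monotone_on_def)
qed

section \<open>Directions whose vertex order is coarser\<close>

text \<open>The hypothesis under which \<open>[v]\<^sub>\<mu> \<mapsto> [v]\<^sub>\<nu>\<close> makes sense and is monotone. It holds for \<open>\<nu>\<close> in a face of the
  cell of \<open>\<mu>\<close>, and in both directions for two directions in one cell.\<close>

definition coarsens :: "'v set set \<Rightarrow> ('v \<Rightarrow> 'a::euclidean_space) \<Rightarrow> 'a \<Rightarrow> 'a \<Rightarrow> bool" where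
  "coarsens K \<phi> \<mu> \<nu> \<longleftrightarrow> (\<forall>v\<in>vertices K. \<forall>w\<in>vertices K.
     vertex_height \<phi> \<mu> v \<le> vertex_height \<phi> \<mu> w \<longrightarrow> vertex_height \<phi> \<nu> v \<le> vertex_height \<phi> \<nu> w)"

lemma height_class_eq:
  assumes "coarsens K \<phi> \<mu> \<nu>" "coarsens K \<phi> \<nu> \<mu>" "v \<in> vertices K"
  shows "height_class K \<phi> \<mu> v = height_class K \<phi> \<nu> v"
proof -
  have "vertex_height \<phi> \<mu> w = vertex_height \<phi> \<mu> v \<longleftrightarrow> vertex_height \<phi> \<nu> w = vertex_height \<phi> \<nu> v"
    if "w \<in> vertices K" for w
    using assms that unfolding coarsens_def by (metis order_antisym order_refl)
  then show ?thesis by (auto simp: height_class_def)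
qed

lemma dir_filtration_eq:
  assumes K: "simplicial_complex K" and "coarsens K \<phi> \<mu> \<nu>" "coarsens K \<phi> \<nu> \<mu>"
  shows "dir_poset K \<phi> \<mu> = dir_poset K \<phi> \<nu>" and "dir_map K \<phi> \<mu> = dir_map K \<phi> \<nu>"
proof -
  have iff: "vertex_height \<phi> \<mu> v \<le> vertex_height \<phi> \<mu> w \<longleftrightarrow> vertex_height \<phi> \<nu> v \<le> vertex_height \<phi> \<nu> w"
    if "v \<in> vertices K" "w \<in> vertices K" for v w
    using assms(2,3) that by (auto simp: coarsens_def)
  note class_eq = height_class_eq[OF assms(2,3)]
  show poset: "dir_poset K \<phi> \<mu> = dir_poset K \<phi> \<nu>"
    unfolding dir_poset_def
    by (intro arg_cong2[where f = "(\<union>)"] refl Collect_cong) (metis class_eq iff)+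
  show "dir_map K \<phi> \<mu> = dir_map K \<phi> \<nu>"
  proof (rule extensionalityI)
    show "dir_map K \<phi> \<mu> \<in> extensional (Field (dir_poset K \<phi> \<mu>))" by (simp add: dir_map_def)
    show "dir_map K \<phi> \<nu> \<in> extensional (Field (dir_poset K \<phi> \<mu>))" by (simp add: dir_map_def poset)
    fix p assume "p \<in> Field (dir_poset K \<phi> \<mu>)"
    then consider "p = None" | v where "v \<in> vertices K" "p = Some (height_class K \<phi> \<mu> v)"
      by (auto simp: Field_dir_poset)
    then show "dir_map K \<phi> \<mu> p = dir_map K \<phi> \<nu> p"
    proof cases
      case 2
      have "w \<in> vertices K" if "w \<in> \<sigma>" "\<sigma> \<in> K" for w \<sigma> using that by (auto simp: vertices_def)
      then show ?thesis
        using 2 iff dir_map_class[OF K 2(1), of \<phi> \<mu>] dir_map_class[OF K 2(1), of \<phi> \<nu>] class_eq[OF 2(1)]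
        by auto
    qed (simp add: dir_map_None)
  qed
qed

lemma class_map_unique:
  assumes "class_map K \<phi> \<mu> \<nu> \<alpha>" "class_map K \<phi> \<mu> \<nu> \<beta>"
  shows "\<alpha> = \<beta>"
  using assms
  by (intro extensionalityI[of _ "Field (dir_poset K \<phi> \<mu>)"]) (auto simp: class_map_def Field_dir_poset)

text \<open>The assignment on classes is independent of the representative since vertices of equal \<open>\<mu>\<close>-height
  have equal \<open>\<nu>\<close>-height (apply coarsening to both inequalities).\<close>

lemma class_map_exists:
  assumes "coarsens K \<phi> \<mu> \<nu>"
  shows "\<exists>\<alpha>. class_map K \<phi> \<mu> \<nu> \<alpha>"
proof -
  define \<alpha> where "\<alpha> = (\<lambda>p\<in>Field (dir_poset K \<phi> \<mu>).
    map_option (\<lambda>c. height_class K \<phi> \<nu> (SOME v. v \<in> c)) p)"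
  have "height_class K \<phi> \<nu> (SOME w. w \<in> height_class K \<phi> \<mu> v) = height_class K \<phi> \<nu> v"
    if v: "v \<in> vertices K" for v
  proof -
    have "v \<in> height_class K \<phi> \<mu> v" using v by (simp add: height_class_def)
    then have "(SOME w. w \<in> height_class K \<phi> \<mu> v) \<in> height_class K \<phi> \<mu> v" by (rule someI)
    moreover have "vertex_height \<phi> \<nu> x = vertex_height \<phi> \<nu> v" if "x \<in> height_class K \<phi> \<mu> v" for x
      using that v assms by (simp add: coarsens_def height_class_def order_eq_iff)
    ultimately have "vertex_height \<phi> \<nu> (SOME w. w \<in> height_class K \<phi> \<mu> v) = vertex_height \<phi> \<nu> v"
      by blast
    then show ?thesis by (simp add: height_class_def)
  qed
  then have "class_map K \<phi> \<mu> \<nu> \<alpha>" by (auto simp: class_map_def \<alpha>_def Field_dir_poset)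
  then show ?thesis by blast
qed

lemma class_map_compose:
  assumes "class_map K \<phi> \<mu> \<nu> \<alpha>" "class_map K \<phi> \<nu> \<xi> \<beta>"
  shows "class_map K \<phi> \<mu> \<xi> (compose (Field (dir_poset K \<phi> \<mu>)) \<beta> \<alpha>)"
  using assms by (auto simp: class_map_def compose_eq Field_dir_poset)

lemma class_map_id: "class_map K \<phi> \<mu> \<mu> (\<lambda>p\<in>Field (dir_poset K \<phi> \<mu>). p)"
  by (auto simp: class_map_def Field_dir_poset)

text \<open>The bottom is preserved because a vertex that is lowest for \<open>\<mu>\<close> is also lowest for \<open>\<nu>\<close>; a complex
  without vertices has only the top.\<close>

lemma bounded_monotone_class_map:
  assumes fin: "finite (vertices K)" and coarse: "coarsens K \<phi> \<mu> \<nu>" and \<alpha>: "class_map K \<phi> \<mu> \<nu> \<alpha>"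
  shows "bounded_monotone (dir_poset K \<phi> \<mu>) (dir_poset K \<phi> \<nu>) \<alpha>"
proof -
  let ?P = "dir_poset K \<phi> \<mu>" and ?Q = "dir_poset K \<phi> \<nu>"
  have \<alpha>_simps: "\<alpha> None = None"
    "\<And>v. v \<in> vertices K \<Longrightarrow> \<alpha> (Some (height_class K \<phi> \<mu> v)) = Some (height_class K \<phi> \<nu> v)"
    and ext: "\<alpha> \<in> extensional (Field ?P)"
    using \<alpha> by (auto simp: class_map_def)
  have maps: "\<alpha> \<in> Field ?P \<rightarrow> Field ?Q"
    by (auto simp: Field_dir_poset \<alpha>_simps)
  have "monotone_on (Field ?P) (\<lambda>x y. (x, y) \<in> ?P) (\<lambda>x y. (x, y) \<in> ?Q) \<alpha>"
  proof (rule monotone_onI)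
    fix p q assume "p \<in> Field ?P" "q \<in> Field ?P" "(p, q) \<in> ?P"
    then show "(\<alpha> p, \<alpha> q) \<in> ?Q"
      using coarse maps
      by (auto simp: Field_dir_poset \<alpha>_simps dir_poset_None dir_poset_from_None dir_poset_classes
          coarsens_def)
  qed
  moreover have "\<alpha> (bot_of ?P) = bot_of ?Q"
  proof (cases "vertices K = {}")
    case True
    then have "bot_of ?P = None" "bot_of ?Q = None"
      using bot_of_props(1)[OF finite_total_poset_dir_poset[OF fin], of \<phi>] by (auto simp: Field_dir_poset)
    then show ?thesis by (simp add: \<alpha>_simps)
  next
    case False
    have "Min (vertex_height \<phi> \<mu> ` vertices K) \<in> vertex_height \<phi> \<mu> ` vertices K"
      by (rule Min_in) (simp_all add: fin False)
    then obtain v where v: "v \<in> vertices K" "vertex_height \<phi> \<mu> v = Min (vertex_height \<phi> \<mu> ` vertices K)"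
      by (elim imageE) simp
    have min: "vertex_height \<phi> \<mu> v \<le> vertex_height \<phi> \<mu> w" if "w \<in> vertices K" for w
      unfolding v(2) using fin that by simp
    then have "vertex_height \<phi> \<nu> v \<le> vertex_height \<phi> \<nu> w" if "w \<in> vertices K" for w
      using coarse that v(1) by (auto simp: coarsens_def)
    then show ?thesis
      using v(1) min bot_of_dir_poset_eq_class[OF fin v(1), of \<phi>] by (simp add: \<alpha>_simps)
  qed
  ultimately show ?thesis
    using maps ext by (simp add: bounded_monotone_def PiE_def top_of_dir_poset[OF fin] \<alpha>_simps)
qed

text \<open>For \<open>a = [w]\<^sub>\<nu>\<close> the adjunction says that \<open>a\<^sup>\<star> = [v]\<^sub>\<mu>\<close> where \<open>u\<close> lies at most as high as \<open>v\<close> for \<open>\<mu>\<close>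
  exactly if it lies at most as high as \<open>w\<close> for \<open>\<nu>\<close>. So the two sublevel subcomplexes have the same
  simplices.\<close>

lemma filtration_preserving_class_map:
  assumes K: "finite K" "simplicial_complex K" and coarse: "coarsens K \<phi> \<mu> \<nu>"
    and \<alpha>: "class_map K \<phi> \<mu> \<nu> \<alpha>"
  shows "filtration_preserving K (dir_filtration K \<phi> \<mu>, dir_filtration K \<phi> \<nu>, \<alpha>)"
proof -
  note fin = finite_vertices[OF K]
  note ftp = finite_total_poset_dir_poset[OF fin]
  note bm = bounded_monotone_class_map[OF fin coarse \<alpha>]
  let ?P = "dir_poset K \<phi> \<mu>" and ?Q = "dir_poset K \<phi> \<nu>"
  have \<alpha>_simps: "\<alpha> None = None"
    "\<And>v. v \<in> vertices K \<Longrightarrow> \<alpha> (Some (height_class K \<phi> \<mu> v)) = Some (height_class K \<phi> \<nu> v)"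
    using \<alpha> by (auto simp: class_map_def)
  have "dir_map K \<phi> \<nu> a = dir_map K \<phi> \<mu> (star ?P ?Q \<alpha> a)" if a: "a \<in> Field ?Q" for a
  proof -
    consider "a = None" | w where "w \<in> vertices K" "a = Some (height_class K \<phi> \<nu> w)"
      using a by (auto simp: Field_dir_poset)
    then show ?thesis
    proof cases
      case 1
      then have "star ?P ?Q \<alpha> a = None"
        using star_eq_top_iff[OF ftp ftp bm a] by (simp add: top_of_dir_poset[OF fin])
      then show ?thesis by (simp add: 1 dir_map_None)
    next
      case 2
      note w = 2(1)
      note star = star_props[OF ftp ftp bm a]
      have "star ?P ?Q \<alpha> a \<noteq> None"
        using star_eq_top_iff[OF ftp ftp bm a] 2(2) by (simp add: top_of_dir_poset[OF fin])
      then obtain v where v: "v \<in> vertices K" "star ?P ?Q \<alpha> a = Some (height_class K \<phi> \<mu> v)"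
        using star(1) by (auto simp: Field_dir_poset)
      have iff: "vertex_height \<phi> \<mu> u \<le> vertex_height \<phi> \<mu> v \<longleftrightarrow> vertex_height \<phi> \<nu> u \<le> vertex_height \<phi> \<nu> w"
        if u: "u \<in> vertices K" for u
        using star(2)[of "Some (height_class K \<phi> \<mu> u)", unfolded v(2)] u v(1) w
        by (simp add: 2(2) \<alpha>_simps dir_poset_classes Field_dir_poset)
      have "(\<forall>u\<in>\<sigma>. vertex_height \<phi> \<nu> u \<le> vertex_height \<phi> \<nu> w)
          \<longleftrightarrow> (\<forall>u\<in>\<sigma>. vertex_height \<phi> \<mu> u \<le> vertex_height \<phi> \<mu> v)" if "\<sigma> \<in> K" for \<sigma>
        using that iff by (intro ball_cong refl) (auto simp: vertices_def)
      then have eq: "{\<sigma> \<in> K. \<forall>u\<in>\<sigma>. vertex_height \<phi> \<nu> u \<le> vertex_height \<phi> \<nu> w}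
          = {\<sigma> \<in> K. \<forall>u\<in>\<sigma>. vertex_height \<phi> \<mu> u \<le> vertex_height \<phi> \<mu> v}"
        by (intro Collect_cong conj_cong refl)
      have "dir_map K \<phi> \<nu> a = {\<sigma> \<in> K. \<forall>u\<in>\<sigma>. vertex_height \<phi> \<mu> u \<le> vertex_height \<phi> \<mu> v}"
        unfolding 2(2) dir_map_class[OF K(2) w] by (rule eq)
      also have "\<dots> = dir_map K \<phi> \<mu> (star ?P ?Q \<alpha> a)"
        unfolding v(2) by (rule dir_map_class[OF K(2) v(1), symmetric])
      finally show ?thesis .
    qed
  qed
  moreover have "is_filtration K (dir_poset K \<phi> \<xi>, dir_map K \<phi> \<xi>)" for \<xi>
    using is_filtration_dir_filtration[OF K] by (simp only: dir_filtration_def)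
  ultimately show ?thesis
    using bm by (simp only: filtration_preserving_def dir_filtration_def prod.case) blast
qed

section \<open>Cells and vertex orders\<close>

text \<open>The two components are the open hemispheres, in some order. It suffices to know that a component cannot
  meet both hemispheres (intermediate value theorem): as there are only two components and the
  normalisations of \<open>u\<close> and \<open>- u\<close> lie in different ones, each component is a whole hemisphere.\<close>

lemma hemisphere_sides:
  fixes u :: "'a::euclidean_space"
  assumes u: "u \<noteq> 0"
    and comps: "components (unit_sphere - {\<mu> \<in> unit_sphere. u \<bullet> \<mu> = 0}) = {M, N}" and "M \<noteq> N"
  shows "\<exists>s\<noteq>0. \<forall>\<mu>\<in>unit_sphere. \<mu> \<in> M \<longleftrightarrow> s * (u \<bullet> \<mu>) < 0"
proof -
  let ?X = "unit_sphere - {\<mu> \<in> unit_sphere. u \<bullet> \<mu> = 0}"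
  have "?X = \<Union>{M, N}" unfolding comps[symmetric] by (rule Union_components[symmetric])
  then have X: "?X = M \<union> N" by (simp only: Union_insert Union_empty Un_empty_right)
  have disj: "M \<inter> N = {}"
    using components_nonoverlap[of M ?X N] comps \<open>M \<noteq> N\<close> by auto
  have conn: "connected M" "connected N"
    using in_components_connected[of _ ?X] comps by auto
  have same_side: "0 < u \<bullet> y" if C: "connected C" "C \<subseteq> ?X" "x \<in> C" "y \<in> C" "0 < u \<bullet> x" for C x y
  proof (rule ccontr)
    assume "\<not> 0 < u \<bullet> y"
    then obtain z where "z \<in> C" "u \<bullet> z = 0"
      using connected_ivt_hyperplane[OF C(1,4,3), of u 0] C(5) by auto
    then show False using C(2) by auto
  qed
  define p where "p = u /\<^sub>R norm u"
  have p: "u \<bullet> p > 0" "u \<bullet> (- p) < 0" "p \<in> ?X" "- p \<in> ?X"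
    using u by (auto simp: p_def)
  have sides: "\<mu> \<in> C \<longleftrightarrow> 0 < u \<bullet> \<mu>"
    if "connected C" "connected D" "C \<union> D = ?X" "C \<inter> D = {}" "p \<in> C" "\<mu> \<in> unit_sphere" for C D \<mu>
  proof
    show "0 < u \<bullet> \<mu>" if "\<mu> \<in> C"
      using same_side[of C p \<mu>] that \<open>connected C\<close> \<open>C \<union> D = ?X\<close> \<open>p \<in> C\<close> p(1) by blast
    assume pos: "0 < u \<bullet> \<mu>"
    show "\<mu> \<in> C"
    proof (rule ccontr)
      assume "\<mu> \<notin> C"
      moreover have "\<mu> \<in> ?X" using pos \<open>\<mu> \<in> unit_sphere\<close> by auto
      ultimately have "\<mu> \<in> D" using \<open>C \<union> D = ?X\<close> by blast
      have "- p \<notin> C"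
        using same_side[of C p "- p"] \<open>connected C\<close> \<open>C \<union> D = ?X\<close> \<open>p \<in> C\<close> p(1,2) by fastforce
      then have "- p \<in> D" using p(4) \<open>C \<union> D = ?X\<close> by blast
      then have "0 < u \<bullet> (- p)"
        using same_side[of D \<mu> "- p"] \<open>connected D\<close> \<open>C \<union> D = ?X\<close> \<open>\<mu> \<in> D\<close> pos by blast
      then show False using p(2) by simp
    qed
  qed
  show ?thesis
  proof (cases "p \<in> M")
    case True
    then have "\<mu> \<in> M \<longleftrightarrow> (- 1) * (u \<bullet> \<mu>) < 0" if "\<mu> \<in> unit_sphere" for \<mu>
      using sides[OF conn X[symmetric] disj True that] by simp
    then show ?thesis by (intro exI[of _ "-1"]) auto
  next
    case False
    then have "p \<in> N" using p(3) unfolding X by simp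
    have "N \<union> M = ?X" "N \<inter> M = {}" using disj unfolding X by blast+
    then have N: "\<mu> \<in> N \<longleftrightarrow> 0 < u \<bullet> \<mu>" if "\<mu> \<in> unit_sphere" for \<mu>
      using sides[OF conn(2,1) _ _ \<open>p \<in> N\<close> that] by blast
    have "\<mu> \<in> M \<longleftrightarrow> 1 * (u \<bullet> \<mu>) < 0" if \<mu>: "\<mu> \<in> unit_sphere" for \<mu>
    proof -
      have "\<mu> \<in> M \<union> N \<longleftrightarrow> u \<bullet> \<mu> \<noteq> 0" unfolding X[symmetric] using \<mu> by auto
      then show ?thesis using N[OF \<mu>] disj by fastforce
    qed
    then show ?thesis by (intro exI[of _ 1]) auto
  qed
qed

lemma inj_on_vertices:
  assumes "geometric_complex K \<phi>"
  shows "inj_on \<phi> (vertices K)"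
proof (rule inj_onI)
  fix v w assume v: "v \<in> vertices K" and w: "w \<in> vertices K" and eq: "\<phi> v = \<phi> w"
  let ?pt = "\<lambda>v w. if w = v then 1 else 0 :: real"
  have pt: "?pt u \<in> underlying_space K" if "u \<in> vertices K" for u
    using that vertex_point_in_closed_simplex[of K _ u] assms
    by (auto simp: vertices_def geometric_complex_def closed_simplex_def)
  have "?pt v = ?pt w"
  proof (rule inj_onD[OF _ _ pt[OF v] pt[OF w]])
    show "inj_on (pl_map \<phi>) (underlying_space K)" using assms by (simp add: geometric_complex_def)
    show "pl_map \<phi> (?pt v) = pl_map \<phi> (?pt w)" using eq by (simp add: pl_map_vertex)
  qed
  from fun_cong[OF this, of v] show "v = w" by (simp split: if_splits)
qed

text \<open>At the index of a pair of vertices the sign vector records which vertex is higher, with the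
  orientation \<open>s\<close> fixed by the choice of sides. Injectivity of \<open>\<phi>\<close> ensures that the pair determines a
  genuine great sphere.\<close>

lemma sign_vector_pair:
  assumes geo: "geometric_complex K \<phi>" and A: "induced_arrangement K \<phi> A"
    and vw: "v \<in> vertices K" "w \<in> vertices K" "v \<noteq> w"
  obtains s :: real where "s \<noteq> 0" "Inl {v, w} \<in> Index A"
    "\<forall>\<mu>\<in>unit_sphere. sign_vector A \<mu> (Inl {v, w}) =
      (if s * (vertex_height \<phi> \<mu> v - vertex_height \<phi> \<mu> w) < 0 then Neg
       else if vertex_height \<phi> \<mu> v = vertex_height \<phi> \<mu> w then Zero else Pos)"
proof -
  let ?i = "Inl {v, w}" and ?u = "\<phi> v - \<phi> w"
  have e: "{v, w} \<in> vertex_pairs K" using vw by (auto simp: vertex_pairs_def)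
  have i: "?i \<in> Index A" and sph: "Sph A ?i = pair_sphere \<phi> {v, w}"
    using A e by (auto simp: induced_arrangement_def)
  have sph': "Sph A ?i = {\<mu> \<in> unit_sphere. ?u \<bullet> \<mu> = 0}"
    unfolding sph pair_sphere_def by (auto simp: inner_diff_left)
  have comps: "components (unit_sphere - Sph A ?i) = {Minus A ?i, Plus A ?i}" "Minus A ?i \<noteq> Plus A ?i"
    using A i by (auto simp: induced_arrangement_def)
  have u: "?u \<noteq> 0" using inj_onD[OF inj_on_vertices[OF geo], of v w] vw by auto
  obtain s where s: "s \<noteq> 0" "\<forall>\<mu>\<in>unit_sphere. \<mu> \<in> Minus A ?i \<longleftrightarrow> s * (?u \<bullet> \<mu>) < 0"
    using hemisphere_sides[OF u comps(1)[unfolded sph'] comps(2)] by blast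
  show thesis
  proof (rule that[OF s(1) i], rule ballI)
    fix \<mu> :: 'b assume "\<mu> \<in> unit_sphere"
    then show "sign_vector A \<mu> ?i =
      (if s * (vertex_height \<phi> \<mu> v - vertex_height \<phi> \<mu> w) < 0 then Neg
       else if vertex_height \<phi> \<mu> v = vertex_height \<phi> \<mu> w then Zero else Pos)"
      using s(2) i by (simp add: sign_vector_def sph' vertex_height_def inner_diff_left)
  qed
qed

text \<open>Passing to a face can only replace signs by zero, that is, turn strict comparisons of vertex heights
  into equalities, never reverse them.\<close>

lemma coarsens_if_sign_vector_le:
  assumes geo: "geometric_complex K \<phi>" and A: "induced_arrangement K \<phi> A"
    and \<nu>: "\<nu> \<in> unit_sphere" and \<mu>: "\<mu> \<in> unit_sphere"
    and le: "\<And>i. i \<in> Index A \<Longrightarrow> sign_vector A \<nu> i \<le> sign_vector A \<mu> i"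
  shows "coarsens K \<phi> \<mu> \<nu>"
  unfolding coarsens_def
proof (intro ballI impI)
  fix v w assume vw: "v \<in> vertices K" "w \<in> vertices K"
    and h: "vertex_height \<phi> \<mu> v \<le> vertex_height \<phi> \<mu> w"
  show "vertex_height \<phi> \<nu> v \<le> vertex_height \<phi> \<nu> w"
  proof (cases "v = w")
    case False
    obtain s :: real where s: "s \<noteq> 0" "Inl {v, w} \<in> Index A"
      "\<forall>\<mu>\<in>unit_sphere. sign_vector A \<mu> (Inl {v, w}) =
        (if s * (vertex_height \<phi> \<mu> v - vertex_height \<phi> \<mu> w) < 0 then Neg
         else if vertex_height \<phi> \<mu> v = vertex_height \<phi> \<mu> w then Zero else Pos)"
      by (rule sign_vector_pair[OF geo A vw False])
    show ?thesis
      using le[OF s(2)] s(1) h unfolding bspec[OF s(3) \<nu>] bspec[OF s(3) \<mu>]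
      by (cases "s > 0")
         (auto simp: less_eq_sign_def mult_less_0_iff not_less split: if_splits)
  qed simp
qed

lemma mem_cell: "\<mu> \<in> cell A f \<longleftrightarrow> \<mu> \<in> unit_sphere \<and> sign_vector A \<mu> = f"
  by (auto simp: cell_def)

lemma cell_leD:
  assumes "cell_le A C D" "\<nu> \<in> C" "\<mu> \<in> D"
  shows "\<nu> \<in> unit_sphere" "\<mu> \<in> unit_sphere"
    and "i \<in> Index A \<Longrightarrow> sign_vector A \<nu> i \<le> sign_vector A \<mu> i"
  using assms by (auto simp: cell_le_def mem_cell)

lemma cells_nonempty: "C \<in> cells A \<Longrightarrow> C \<noteq> {}"
  by (auto simp: cells_def cell_def)

lemma cell_le_refl: "C \<in> cells A \<Longrightarrow> cell_le A C C"
  by (auto simp: cells_def cell_le_def)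

text \<open>A cell is nonempty, so it determines its sign vector; this identifies the two sign vectors
  witnessing the two relations at the middle cell.\<close>

lemma cell_le_trans:
  assumes "cell_le A C D" "cell_le A D E"
  shows "cell_le A C E"
proof -
  obtain f g where fg: "f \<in> sign_vector A ` unit_sphere" "g \<in> sign_vector A ` unit_sphere"
    "C = cell A f" "D = cell A g" "\<forall>i\<in>Index A. f i \<le> g i"
    using assms(1) unfolding cell_le_def by blast
  obtain g' h where gh: "h \<in> sign_vector A ` unit_sphere"
    "D = cell A g'" "E = cell A h" "\<forall>i\<in>Index A. g' i \<le> h i"
    using assms(2) unfolding cell_le_def by blast
  from fg(2) obtain \<mu> where "\<mu> \<in> unit_sphere" "sign_vector A \<mu> = g" by auto
  then have "\<mu> \<in> cell A g" by (simp add: mem_cell)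
  then have "g' = g" using fg(4) gh(2) by (metis mem_cell)
  then have "\<forall>i\<in>Index A. f i \<le> h i" using fg(5) gh(4) by (meson order_trans)
  then show ?thesis using fg(1,3) gh(1,3) unfolding cell_le_def by blast
qed

section \<open>The functor on the cells\<close>

lemma geometric_complexD:
  assumes "geometric_complex K \<phi>"
  shows "finite K" "simplicial_complex K"
  using assms by (simp_all add: geometric_complex_def)

context
  fixes K :: "'v set set" and \<phi> :: "'v \<Rightarrow> 'a::euclidean_space"
    and A :: "('v set + 'j, 'a) arrangement"
  assumes geo: "geometric_complex K \<phi>" and arr: "induced_arrangement K \<phi> A"
begin

lemmas complex = geometric_complexD[OF geo]

lemma coarsens_cell_le:
  assumes "cell_le A C D" "\<nu> \<in> C" "\<mu> \<in> D"
  shows "coarsens K \<phi> \<mu> \<nu>"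
  using coarsens_if_sign_vector_le[OF geo arr cell_leD[OF assms]] .

lemma dir_filtration_eq_on_cell:
  assumes "C \<in> cells A" "\<mu> \<in> C" "\<nu> \<in> C"
  shows "dir_poset K \<phi> \<mu> = dir_poset K \<phi> \<nu>" "dir_map K \<phi> \<mu> = dir_map K \<phi> \<nu>"
    "dir_filtration K \<phi> \<mu> = dir_filtration K \<phi> \<nu>"
proof -
  note coarse = coarsens_cell_le[OF cell_le_refl[OF assms(1)]]
  note eq = dir_filtration_eq[OF complex(2) coarse[OF assms(3,2)] coarse[OF assms(2,3)]]
  show "dir_poset K \<phi> \<mu> = dir_poset K \<phi> \<nu>" "dir_map K \<phi> \<mu> = dir_map K \<phi> \<nu>"
    "dir_filtration K \<phi> \<mu> = dir_filtration K \<phi> \<nu>"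
    by (simp_all only: eq dir_filtration_def)
qed

lemma cell_filtration_eq:
  assumes "C \<in> cells A" "\<mu> \<in> C"
  shows "cell_filtration K \<phi> C = dir_filtration K \<phi> \<mu>"
  unfolding cell_filtration_def
  by (rule the_equality) (use assms dir_filtration_eq_on_cell(3)[OF assms(1)] in blast)+

text \<open>The description operator in the morphism of a pair of cells asks for one map that works for all pairs of
  directions in the two cells.\<close>

lemma class_map_between_cells:
  assumes C: "C \<in> cells A" "D \<in> cells A" "cell_le A C D"
    and "\<nu> \<in> C" "\<nu>' \<in> C" "\<mu> \<in> D" "\<mu>' \<in> D" "class_map K \<phi> \<mu> \<nu> \<alpha>"
  shows "class_map K \<phi> \<mu>' \<nu>' \<alpha>"
proof -
  have coarse: "coarsens K \<phi> \<mu> \<mu>'" "coarsens K \<phi> \<mu>' \<mu>" "coarsens K \<phi> \<nu> \<nu>'" "coarsens K \<phi> \<nu>' \<nu>"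
    using coarsens_cell_le cell_le_refl C(1,2) assms(4-7) by blast+
  have "height_class K \<phi> \<mu>' v = height_class K \<phi> \<mu> v" "height_class K \<phi> \<nu>' v = height_class K \<phi> \<nu> v"
    if "v \<in> vertices K" for v
    by (rule height_class_eq[OF coarse(2,1) that], rule height_class_eq[OF coarse(4,3) that])
  moreover have "dir_poset K \<phi> \<mu>' = dir_poset K \<phi> \<mu>"
    using dir_filtration_eq_on_cell(1)[OF C(2)] assms by blast
  ultimately show ?thesis using assms(8) by (simp add: class_map_def)
qed

lemma cell_arrow_eq:
  assumes C: "C \<in> cells A" "D \<in> cells A" "cell_le A C D"
    and \<nu>: "\<nu> \<in> C" and \<mu>: "\<mu> \<in> D" and \<alpha>: "class_map K \<phi> \<mu> \<nu> \<alpha>"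
  shows "cell_arrow K \<phi> (C, D) = (cell_filtration K \<phi> D, cell_filtration K \<phi> C, \<alpha>)"
proof -
  have "(THE \<alpha>. \<forall>\<nu>\<in>C. \<forall>\<mu>\<in>D. class_map K \<phi> \<mu> \<nu> \<alpha>) = \<alpha>"
  proof (rule the_equality)
    show "\<forall>\<nu>\<in>C. \<forall>\<mu>\<in>D. class_map K \<phi> \<mu> \<nu> \<alpha>"
      using class_map_between_cells[OF C \<nu> _ \<mu> _ \<alpha>] by blast
    show "\<beta> = \<alpha>" if "\<forall>\<nu>\<in>C. \<forall>\<mu>\<in>D. class_map K \<phi> \<mu> \<nu> \<beta>" for \<beta>
      using that class_map_unique[OF _ \<alpha>] \<nu> \<mu> by blast
  qed
  then show ?thesis by (simp add: cell_arrow_def)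
qed

lemma cell_arrow_cases:
  assumes C: "C \<in> cells A" "D \<in> cells A" "cell_le A C D" and \<nu>: "\<nu> \<in> C" and \<mu>: "\<mu> \<in> D"
  obtains \<alpha> where "class_map K \<phi> \<mu> \<nu> \<alpha>"
    "cell_arrow K \<phi> (C, D) = (dir_filtration K \<phi> \<mu>, dir_filtration K \<phi> \<nu>, \<alpha>)"
proof -
  obtain \<alpha> where \<alpha>: "class_map K \<phi> \<mu> \<nu> \<alpha>"
    using class_map_exists[OF coarsens_cell_le[OF C(3) \<nu> \<mu>]] by blast
  show thesis
    using that[OF \<alpha>] cell_arrow_eq[OF C \<nu> \<mu> \<alpha>] cell_filtration_eq[OF C(1) \<nu>]
      cell_filtration_eq[OF C(2) \<mu>] by simp
qed

lemma cell_arrow_in_Fil: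
  assumes C: "C \<in> cells A" "D \<in> cells A" "cell_le A C D"
  shows "cell_arrow K \<phi> (C, D) \<in> Arr (Fil K)"
proof -
  obtain \<nu> where \<nu>: "\<nu> \<in> C" using cells_nonempty[OF C(1)] by blast
  obtain \<mu> where \<mu>: "\<mu> \<in> D" using cells_nonempty[OF C(2)] by blast
  obtain \<alpha> where "class_map K \<phi> \<mu> \<nu> \<alpha>"
    and eq: "cell_arrow K \<phi> (C, D) = (dir_filtration K \<phi> \<mu>, dir_filtration K \<phi> \<nu>, \<alpha>)"
    using cell_arrow_cases[OF C \<nu> \<mu>] .
  then have "filtration_preserving K (dir_filtration K \<phi> \<mu>, dir_filtration K \<phi> \<nu>, \<alpha>)"
    using filtration_preserving_class_map[OF complex coarsens_cell_le[OF C(3) \<nu> \<mu>]] by blast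
  then show ?thesis unfolding eq by (simp add: Fil_def)
qed

lemma cell_arrow_compose:
  assumes C: "C \<in> cells A" "D \<in> cells A" "E \<in> cells A" and le: "cell_le A C D" "cell_le A D E"
  shows "Comp (Fil K) (cell_arrow K \<phi> (C, D)) (cell_arrow K \<phi> (D, E)) = cell_arrow K \<phi> (C, E)"
proof -
  obtain \<xi> where \<xi>: "\<xi> \<in> C" using cells_nonempty[OF C(1)] by blast
  obtain \<nu> where \<nu>: "\<nu> \<in> D" using cells_nonempty[OF C(2)] by blast
  obtain \<mu> where \<mu>: "\<mu> \<in> E" using cells_nonempty[OF C(3)] by blast
  obtain \<alpha> where \<alpha>: "class_map K \<phi> \<mu> \<nu> \<alpha>"
    and eq\<alpha>: "cell_arrow K \<phi> (D, E) = (dir_filtration K \<phi> \<mu>, dir_filtration K \<phi> \<nu>, \<alpha>)"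
    using cell_arrow_cases[OF C(2,3) le(2) \<nu> \<mu>] .
  obtain \<beta> where \<beta>: "class_map K \<phi> \<nu> \<xi> \<beta>"
    and eq\<beta>: "cell_arrow K \<phi> (C, D) = (dir_filtration K \<phi> \<nu>, dir_filtration K \<phi> \<xi>, \<beta>)"
    using cell_arrow_cases[OF C(1,2) le(1) \<xi> \<nu>] .
  have "cell_arrow K \<phi> (C, E) = (dir_filtration K \<phi> \<mu>, dir_filtration K \<phi> \<xi>,
      compose (Field (dir_poset K \<phi> \<mu>)) \<beta> \<alpha>)"
    using cell_arrow_eq[OF C(1,3) cell_le_trans[OF le] \<xi> \<mu> class_map_compose[OF \<alpha> \<beta>]]
      cell_filtration_eq[OF C(1) \<xi>] cell_filtration_eq[OF C(3) \<mu>] by simp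
  then show ?thesis unfolding eq\<alpha> eq\<beta> by (simp add: Fil_def dir_filtration_def)
qed

lemma cell_filtration_in_Fil:
  assumes "C \<in> cells A"
  shows "cell_filtration K \<phi> C \<in> Obj (Fil K)"
proof -
  obtain \<mu> where "\<mu> \<in> C" using cells_nonempty[OF assms] by blast
  from cell_filtration_eq[OF assms this] show ?thesis
    using is_filtration_dir_filtration[OF complex] by (simp add: Fil_def)
qed

lemma cell_arrow_refl:
  assumes C: "C \<in> cells A"
  shows "cell_arrow K \<phi> (C, C) = Ident (Fil K) (cell_filtration K \<phi> C)"
proof -
  obtain \<mu> where \<mu>: "\<mu> \<in> C" using cells_nonempty[OF C] by blast
  have "fst (cell_filtration K \<phi> C) = dir_poset K \<phi> \<mu>"
    by (simp add: cell_filtration_eq[OF C \<mu>] dir_filtration_def)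
  then show ?thesis
    using cell_arrow_eq[OF C C cell_le_refl[OF C] \<mu> \<mu> class_map_id] by (simp add: Fil_def)
qed

lemma cat_functor_cells:
  "cat_functor (op_cat (poset_cat (cells A) (cell_le A))) (Fil K) (cell_filtration K \<phi>) (cell_arrow K \<phi>)"
proof -
  let ?C = "op_cat (poset_cat (cells A) (cell_le A))"
  have arrow_ends: "fst (cell_arrow K \<phi> f) = cell_filtration K \<phi> (snd f)"
    "fst (snd (cell_arrow K \<phi> f)) = cell_filtration K \<phi> (fst f)" for f
    by (simp_all add: cell_arrow_def split: prod.split)
  interpret C: category ?C
    by (intro category_op category_poset cell_le_refl) (blast intro: cell_le_trans)+
  interpret Fil: category "Fil K" by (rule category_Fil)
  show ?thesis
  proof
    fix C assume "C \<in> Obj ?C"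
    then have C: "C \<in> cells A" by (simp add: op_cat_def poset_cat_def)
    show "cell_filtration K \<phi> C \<in> Obj (Fil K)" by (rule cell_filtration_in_Fil[OF C])
    show "cell_arrow K \<phi> (Ident ?C C) = Ident (Fil K) (cell_filtration K \<phi> C)"
      using cell_arrow_refl[OF C] by (simp add: op_cat_def poset_cat_def)
  next
    fix f assume f: "f \<in> Arr ?C"
    then show "cell_arrow K \<phi> f \<in> Arr (Fil K)"
      using cell_arrow_in_Fil by (cases f) (simp add: op_cat_def poset_cat_def)
    show "Dom (Fil K) (cell_arrow K \<phi> f) = cell_filtration K \<phi> (Dom ?C f)"
      "Cod (Fil K) (cell_arrow K \<phi> f) = cell_filtration K \<phi> (Cod ?C f)"
      by (simp_all add: Fil_def op_cat_def poset_cat_def arrow_ends)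
  next
    fix f g assume "f \<in> Arr ?C" "g \<in> Arr ?C" "Cod ?C f = Dom ?C g"
    then show "cell_arrow K \<phi> (Comp ?C g f) = Comp (Fil K) (cell_arrow K \<phi> g) (cell_arrow K \<phi> f)"
      using cell_arrow_compose by (cases f, cases g) (simp add: op_cat_def poset_cat_def)
  qed
qed

end

theorem mainTheorem1:
  fixes K :: "'v set set"
    and \<phi> :: "'v \<Rightarrow> real ^ 'n"
    and A :: "('v set + 'j, real ^ 'n) arrangement"
    and r :: "'v rel"
    and d :: nat
  assumes "geometric_complex K \<phi>"
    and "induced_arrangement K \<phi> A"
    and "linear_order_on (vertices K) r"
  shows
    "(\<forall>C\<in>cells A. \<forall>\<mu>\<^sub>1\<in>C. \<forall>\<mu>\<^sub>2\<in>C.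
        dir_poset K \<phi> \<mu>\<^sub>1 = dir_poset K \<phi> \<mu>\<^sub>2 \<and>
        dir_map K \<phi> \<mu>\<^sub>1 = dir_map K \<phi> \<mu>\<^sub>2 \<and>
        PH TYPE('k::field) r d (dir_filtration K \<phi> \<mu>\<^sub>1) = PH TYPE('k) r d (dir_filtration K \<phi> \<mu>\<^sub>2)) \<and>
     (\<forall>C\<in>cells A. cell_filtration K \<phi> C \<in> Obj (Fil K) \<and>
        (\<forall>\<mu>\<in>C. cell_filtration K \<phi> C = dir_filtration K \<phi> \<mu>)) \<and>
     (\<forall>C\<^sub>1\<in>cells A. \<forall>C\<^sub>2\<in>cells A. cell_le A C\<^sub>1 C\<^sub>2 \<longrightarrow>
        (\<forall>\<nu>\<in>C\<^sub>1. \<forall>\<mu>\<in>C\<^sub>2.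
           (\<exists>!\<alpha>. class_map K \<phi> \<mu> \<nu> \<alpha>) \<and>
           (\<forall>\<alpha>. class_map K \<phi> \<mu> \<nu> \<alpha> \<longrightarrow>
              bounded_monotone (dir_poset K \<phi> \<mu>) (dir_poset K \<phi> \<nu>) \<alpha> \<and>
              cell_arrow K \<phi> (C\<^sub>1, C\<^sub>2) = (cell_filtration K \<phi> C\<^sub>2, cell_filtration K \<phi> C\<^sub>1, \<alpha>))) \<and>
        cell_arrow K \<phi> (C\<^sub>1, C\<^sub>2) \<in> Arr (Fil K)) \<and>
     (\<forall>C\<^sub>1\<in>cells A. \<forall>C\<^sub>2\<in>cells A. \<forall>C\<^sub>3\<in>cells A. cell_le A C\<^sub>1 C\<^sub>2 \<and> cell_le A C\<^sub>2 C\<^sub>3 \<longrightarrow>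
        Comp (Fil K) (cell_arrow K \<phi> (C\<^sub>1, C\<^sub>2)) (cell_arrow K \<phi> (C\<^sub>2, C\<^sub>3)) =
          cell_arrow K \<phi> (C\<^sub>1, C\<^sub>3)) \<and>
     cat_functor (op_cat (poset_cat (cells A) (cell_le A))) (Fil K)
       (cell_filtration K \<phi>) (cell_arrow K \<phi>) \<and>
     cat_functor (op_cat (poset_cat (cells A) (cell_le A))) Fnc
       (PH TYPE('k) r d \<circ> cell_filtration K \<phi>) (PH_arrow TYPE('k) r d \<circ> cell_arrow K \<phi>) \<and>
     (\<forall>C\<^sub>1\<in>cells A. \<forall>C\<^sub>2\<in>cells A. cell_le A C\<^sub>1 C\<^sub>2 \<longrightarrow>
        charge_preserving (PH_arrow TYPE('k) r d (cell_arrow K \<phi> (C\<^sub>1, C\<^sub>2))))"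
proof (intro conjI ballI impI)
  note geo = assms(1) and arr = assms(2)
  note K = geometric_complexD[OF geo]
  {
    fix C \<mu>\<^sub>1 \<mu>\<^sub>2 assume "C \<in> cells A" "\<mu>\<^sub>1 \<in> C" "\<mu>\<^sub>2 \<in> C"
    note eq = dir_filtration_eq_on_cell[OF geo arr this]
    show "dir_poset K \<phi> \<mu>\<^sub>1 = dir_poset K \<phi> \<mu>\<^sub>2" "dir_map K \<phi> \<mu>\<^sub>1 = dir_map K \<phi> \<mu>\<^sub>2"
      "PH TYPE('k) r d (dir_filtration K \<phi> \<mu>\<^sub>1) = PH TYPE('k) r d (dir_filtration K \<phi> \<mu>\<^sub>2)"
      by (rule eq(1), rule eq(2), simp only: eq(3))
  next
    fix C assume C: "C \<in> cells A"
    show "cell_filtration K \<phi> C \<in> Obj (Fil K)" by (rule cell_filtration_in_Fil[OF geo arr C])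
    show "cell_filtration K \<phi> C = dir_filtration K \<phi> \<mu>" if "\<mu> \<in> C" for \<mu>
      by (rule cell_filtration_eq[OF geo arr C that])
  next
    fix C\<^sub>1 C\<^sub>2 assume C: "C\<^sub>1 \<in> cells A" "C\<^sub>2 \<in> cells A" "cell_le A C\<^sub>1 C\<^sub>2"
    show arrow: "cell_arrow K \<phi> (C\<^sub>1, C\<^sub>2) \<in> Arr (Fil K)" by (rule cell_arrow_in_Fil[OF geo arr C])
    show "charge_preserving (PH_arrow TYPE('k) r d (cell_arrow K \<phi> (C\<^sub>1, C\<^sub>2)))"
      using cat_functor.arr_in[OF cat_functor_PH arrow] by (simp add: Fnc_def)
    fix \<nu> \<mu> assume dirs: "\<nu> \<in> C\<^sub>1" "\<mu> \<in> C\<^sub>2"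
    note coarse = coarsens_cell_le[OF geo arr C(3) dirs]
    show "\<exists>!\<alpha>. class_map K \<phi> \<mu> \<nu> \<alpha>"
      using class_map_exists[OF coarse] class_map_unique by blast
    show "\<forall>\<alpha>. class_map K \<phi> \<mu> \<nu> \<alpha> \<longrightarrow>
        bounded_monotone (dir_poset K \<phi> \<mu>) (dir_poset K \<phi> \<nu>) \<alpha> \<and>
        cell_arrow K \<phi> (C\<^sub>1, C\<^sub>2) = (cell_filtration K \<phi> C\<^sub>2, cell_filtration K \<phi> C\<^sub>1, \<alpha>)"
      using bounded_monotone_class_map[OF finite_vertices[OF K] coarse]
        cell_arrow_eq[OF geo arr C dirs] by blast
  next
    fix C\<^sub>1 C\<^sub>2 C\<^sub>3 assume "C\<^sub>1 \<in> cells A" "C\<^sub>2 \<in> cells A" "C\<^sub>3 \<in> cells A"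
      "cell_le A C\<^sub>1 C\<^sub>2 \<and> cell_le A C\<^sub>2 C\<^sub>3"
    then show "Comp (Fil K) (cell_arrow K \<phi> (C\<^sub>1, C\<^sub>2)) (cell_arrow K \<phi> (C\<^sub>2, C\<^sub>3)) =
        cell_arrow K \<phi> (C\<^sub>1, C\<^sub>3)"
      using cell_arrow_compose[OF geo arr] by blast
  }
  show F: "cat_functor (op_cat (poset_cat (cells A) (cell_le A))) (Fil K)
      (cell_filtration K \<phi>) (cell_arrow K \<phi>)"
    by (rule cat_functor_cells[OF geo arr])
  show "cat_functor (op_cat (poset_cat (cells A) (cell_le A))) Fnc
      (PH TYPE('k) r d \<circ> cell_filtration K \<phi>) (PH_arrow TYPE('k) r d \<circ> cell_arrow K \<phi>)"
    by (rule cat_functor_compose[OF F cat_functor_PH])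
qed

end
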